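(* There exist a function $u_0 : \mathbb{T} \to \mathbb{R}$ with $u_0 \in H^1(\mathbb{T})$, $\| \partial_x u_0 \|_{L^2(\mathbb{T})} \leq 1$ and zero mean $\int_{\mathbb{T}} u_0 \, dx = 0$, and a constant $c_0 > 0$, such that, denoting for each $\nu > 0$ by $u^\nu$ the solution of the viscous Burgers equation $$ \begin{cases} \partial_t u^\nu + u^\nu \partial_x u^\nu = \nu \partial_x^2 u^\nu, & t > 0, \ x \in \mathbb{T}, \\ u^\nu(0,x) = u_0(x), & x \in \mathbb{T}, \end{cases} $$ one has $$ \liminf_{\nu \to 0^+} \, \nu \, \| \partial_x u^\nu \|_{L^\infty_t L^2_x(\mathbb{R}_+ \times \mathbb{T})}^2 \geq c_0 . $$
   Context: $\mathbb{T} = \mathbb{R}/\mathbb{Z}$ is the unit circle (periodic boundary conditions) and $\mathbb{R}_+ = (0,\infty)$. The norm is $\| g \|_{L^\infty_t L^2_x(\mathbb{R}_+\times\mathbb{T})} = \operatorname{ess\,sup}_{t>0} \| g(t,\cdot) \|_{L^2(\mathbb{T})}$. The initial datum $u_0$ and constant $c_0$ do not depend on $\nu$. The solution $u^\nu$ is the unique global solution, bounded on $(0,T)\times\mathbb{T}$ for every $T>0$, understood in the sense of Duhamel's formula $u^\nu(t) = e^{\nu t \partial_x^2} u_0 - \int_0^t \partial_x e^{\nu (t-s)\partial_x^2} \tfrac12 (u^\nu(s))^2 \, ds$, where $e^{\nu t\partial_x^2}$ is the heat semigroup on $\mathbb{T}$; it is smooth for $t>0$. *)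

theory Defs
  imports "HOL-Probability.Probability"
begin

text \<open>
  Functions on the circle \<open>\<real>/\<int>\<close> are represented by 1-periodic functions on the real line;
  integrals over the circle are integrals over the fundamental domain \<open>{0..<1}\<close>.
\<close>

definition circle_fun :: "(real \<Rightarrow> real) \<Rightarrow> bool" where
  "circle_fun f \<longleftrightarrow> (\<forall>x. f (x + 1) = f x)"

definition ennreal_sqrt :: "ennreal \<Rightarrow> ennreal" where
  "ennreal_sqrt a = (if a = \<infinity> then \<infinity> else ennreal (sqrt (enn2real a)))"

definition L2_norm :: "(real \<Rightarrow> real) \<Rightarrow> ennreal" where
  "L2_norm f = ennreal_sqrt (\<integral>\<^sup>+ x \<in> {0..<1}. ennreal ((f x)\<^sup>2) \<partial>lborel)"

definition L2 :: "(real \<Rightarrow> real) set" where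
  "L2 = {f. circle_fun f \<and> f \<in> borel_measurable lborel \<and> L2_norm f < \<infinity>}"

definition test_fun :: "(real \<Rightarrow> real) \<Rightarrow> bool" where
  "test_fun \<phi> \<longleftrightarrow> circle_fun \<phi> \<and> (\<forall>k. (deriv ^^ k) \<phi> differentiable_on UNIV)"

text \<open>Only meaningful for \<open>u\<close> and \<open>g\<close> integrable on the circle; it is used on \<open>L2\<close> only.\<close>

definition has_weak_deriv :: "(real \<Rightarrow> real) \<Rightarrow> (real \<Rightarrow> real) \<Rightarrow> bool" where
  "has_weak_deriv u g \<longleftrightarrow> (\<forall>\<phi>. test_fun \<phi> \<longrightarrow>
     (\<integral>x\<in>{0..<1}. u x * deriv \<phi> x \<partial>lborel) = - (\<integral>x\<in>{0..<1}. g x * \<phi> x \<partial>lborel))"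

definition H1 :: "(real \<Rightarrow> real) set" where
  "H1 = {u \<in> L2. \<exists>g\<in>L2. has_weak_deriv u g}"

text \<open>
  \<open>heat \<tau>\<close> is \<open>e\<^sup>\<tau>\<^sup>\<Delta>\<close> in one space dimension. For 1-periodic \<open>f\<close>, the convolution over the real line
  equals the convolution over the circle with the periodised kernel
  \<open>\<Sum>k\<in>\<int>. heat_kernel \<tau> (x - y - k)\<close>, so this is the heat semigroup of the circle.
\<close>

definition heat_kernel :: "real \<Rightarrow> real \<Rightarrow> real" where
  "heat_kernel \<tau> x = exp (- (x\<^sup>2 / (4 * \<tau>))) / sqrt (4 * pi * \<tau>)"

definition heat :: "real \<Rightarrow> (real \<Rightarrow> real) \<Rightarrow> real \<Rightarrow> real" where
  "heat \<tau> f x = (if \<tau> = 0 then f x else (\<integral>y. heat_kernel \<tau> (x - y) * f y \<partial>lborel))"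

text \<open>
  Bounded solutions in the sense of Duhamel's formula. The formula is required at every point, which
  selects the representative that is smooth for \<open>t > 0\<close>; at \<open>t = 0\<close> it reads \<open>u 0 = u0\<close>.
  Measurability is part of being a bounded (\<open>L\<^sup>\<infinity>\<close>) function, and without it the integrals would be
  given junk values. Values at negative times are irrelevant.
\<close>

definition burgers_solution ::
  "real \<Rightarrow> (real \<Rightarrow> real) \<Rightarrow> (real \<Rightarrow> real \<Rightarrow> real) \<Rightarrow> bool" where
  "burgers_solution \<nu> u0 u \<longleftrightarrow>
     (\<forall>t\<ge>0. circle_fun (u t)) \<and>
     (\<lambda>(t, x). u t x) \<in> borel_measurable (restrict_space borel ({0<..} \<times> UNIV)) \<and>
     (\<forall>T>0. \<exists>M. \<forall>t\<in>{0<..<T}. \<forall>x. \<bar>u t x\<bar> \<le> M) \<and>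
     (\<forall>t\<ge>0. \<forall>x. u t x = heat (\<nu> * t) u0 x
        - (\<integral>s\<in>{0<..<t}. deriv (heat (\<nu> * (t - s)) (\<lambda>y. (u s y)\<^sup>2 / 2)) x \<partial>lborel))"

definition Linf_L2_norm :: "(real \<Rightarrow> real \<Rightarrow> real) \<Rightarrow> ennreal" where
  "Linf_L2_norm g = esssup (restrict_space lborel {0<..}) (\<lambda>t. L2_norm (g t))"

end

theory Submission
  imports Defs
begin

text \<open>
  Take \<open>u0 x = sin (2 * pi * x) / 8\<close>. Bounded Duhamel solutions are unique, because the gradient of
  the heat semigroup has norm at most \<open>1 / sqrt \<tau>\<close>, so all solutions are the Cole-Hopf solution
  \<open>-2 \<nu> \<phi>\<^sub>x / \<phi>\<close>. Writing \<open>\<phi>\<close> as a Laplace transform shows that it satisfies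
  Oleinik's bound \<open>u\<^sub>x \<le> 1 / t\<close>, which together with the zero mean gives \<open>\<bar>u\<bar> \<le> 1 / t\<close>, uniformly
  in \<open>\<nu>\<close>. Hence half of the initial energy is lost by time 16. Since the energy decays at rate
  \<open>\<nu> \<parallel>u\<^sub>x\<parallel>\<^sup>2\<close>, this quantity exceeds a constant independent of \<open>\<nu>\<close> at some time.
\<close>

text \<open>The theorem speaks about every bounded Duhamel solution, while the estimates need a
  formula. Uniqueness carries them over; in return the explicit formula must be shown to satisfy
  Duhamel's identity. Cole-Hopf reduces existence, smoothness and boundedness to the heat semigroup,
  since all derivatives of the solution are polynomials in quotients of heat evolutions. The
  obstacle is uniformity in \<nu>: the transformed datum ranges over [exp (-c), exp c] with c of
  order 1/\<nu>, so bounds through its maximum and minimum are useless in the limit. Only the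
  Oleinik inequality, in which \<nu> cancels, enters the final constant. The amplitude 1/8 makes the
  gradient norm at most 1 because 2 pi / 8 < 1. The initial energy, half of the squared norm, is
  then 1/256, and T = 16 is the time at which the Oleinik bound 1 / (2 T^2) on the energy equals
  half of that. The resulting inequality holds for every \<nu> > 0 and not only in the
  limit.\<close>

section \<open>Differentiation under the integral sign\<close>

lemma has_real_derivative_lebesgue_integral:
  fixes f f' :: "real \<Rightarrow> 'a \<Rightarrow> real"
  assumes e: "e > 0"
    and int: "\<And>t. \<bar>t - a\<bar> < e \<Longrightarrow> integrable M (f t)"
    and der: "\<And>t y. \<bar>t - a\<bar> < e \<Longrightarrow> ((\<lambda>t. f t y) has_real_derivative f' t y) (at t)"
    and meas [measurable]: "f' a \<in> borel_measurable M"
    and bound: "\<And>t y. \<bar>t - a\<bar> < e \<Longrightarrow> \<bar>f' t y\<bar> \<le> g y"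
    and g: "integrable M g"
  shows "((\<lambda>t. \<integral>y. f t y \<partial>M) has_real_derivative (\<integral>y. f' a y \<partial>M)) (at a)"
proof -
  define S where "S = ball a e"
  have S: "open S" "convex S" "a \<in> S" and S_iff: "t \<in> S \<longleftrightarrow> \<bar>t - a\<bar> < e" for t
    using e by (auto simp: S_def dist_real_def)
  \<comment> \<open>The mean value inequality on the interval \<open>S\<close> turns the bound on
    the derivative into one on difference quotients, which \<open>g\<close> then dominates.\<close>
  have lip: "\<bar>f t y - f a y\<bar> \<le> g y * \<bar>t - a\<bar>" if "t \<in> S" for t y
    using field_differentiable_bound[OF S(2), of "\<lambda>t. f t y" "\<lambda>t. f' t y" "g y" t a]
      der bound S that by (auto simp: S_iff intro: has_field_derivative_at_within)
  have "((\<lambda>t. \<integral>y. f t y \<partial>M) has_real_derivative (\<integral>y. f' a y \<partial>M)) (at a within S)"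
    unfolding has_field_derivative_iff tendsto_at_iff_sequentially comp_def
  proof (intro allI impI)
    fix X assume X: "\<forall>i. X i \<in> S - {a}" and lim: "X \<longlonglongrightarrow> a"
    have XS: "X i \<in> S" "X i \<noteq> a" for i using X by auto
    have eq: "((\<integral>y. f (X i) y \<partial>M) - (\<integral>y. f a y \<partial>M)) / (X i - a)
      = (\<integral>y. (f (X i) y - f a y) / (X i - a) \<partial>M)" for i
      using int[of "X i"] int[of a] XS e by (simp add: S_iff)
    show "(\<lambda>i. ((\<integral>y. f (X i) y \<partial>M) - (\<integral>y. f a y \<partial>M)) / (X i - a)) \<longlonglongrightarrow> (\<integral>y. f' a y \<partial>M)"
      unfolding eq
    proof (rule integral_dominated_convergence[where w = g])
      show "(\<lambda>y. (f (X i) y - f a y) / (X i - a)) \<in> borel_measurable M" for i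
        using int[of "X i"] int[of a] XS e by (auto simp: S_iff)
      show "AE y in M. (\<lambda>i. (f (X i) y - f a y) / (X i - a)) \<longlonglongrightarrow> f' a y"
      proof (intro AE_I2)
        fix y
        have "((\<lambda>t. (f t y - f a y) / (t - a)) \<longlongrightarrow> f' a y) (at a)"
          using der[of a y] e by (simp add: has_field_derivative_iff)
        moreover have "filterlim X (at a) sequentially"
          using lim XS by (simp add: filterlim_at)
        ultimately show "(\<lambda>i. (f (X i) y - f a y) / (X i - a)) \<longlonglongrightarrow> f' a y"
          by (rule filterlim_compose)
      qed
      show "AE y in M. norm ((f (X i) y - f a y) / (X i - a)) \<le> g y" for i
        using lip[OF XS(1)] XS(2) by (auto simp: divide_le_eq)
    qed (use g in auto)
  qed
  then show ?thesis by (simp only: at_within_open[OF S(3) S(1)])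
qed

section \<open>The heat semigroup on bounded functions\<close>

lemma heat_kernel_normal: "\<tau> > 0 \<Longrightarrow> heat_kernel \<tau> = normal_density 0 (sqrt (2 * \<tau>))"
  by (auto simp: heat_kernel_def normal_density_def fun_eq_iff)

lemma heat_kernel_measurable [measurable]: "heat_kernel \<tau> \<in> borel_measurable borel"
  unfolding heat_kernel_def by measurable

lemma heat_kernel_nonneg: "\<tau> > 0 \<Longrightarrow> heat_kernel \<tau> z \<ge> 0"
  by (simp add: heat_kernel_normal)

definition heat_kernel_x :: "real \<Rightarrow> real \<Rightarrow> real" where
  "heat_kernel_x \<tau> z = - (z / (2 * \<tau>)) * heat_kernel \<tau> z"

definition heat_kernel_xx :: "real \<Rightarrow> real \<Rightarrow> real" where
  "heat_kernel_xx \<tau> z = (z\<^sup>2 / (4 * \<tau>\<^sup>2) - 1 / (2 * \<tau>)) * heat_kernel \<tau> z"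

lemma heat_kernel_x_measurable [measurable]:
  "heat_kernel_x \<tau> \<in> borel_measurable borel"
  "heat_kernel_xx \<tau> \<in> borel_measurable borel"
  unfolding heat_kernel_x_def heat_kernel_xx_def by measurable

lemma heat_kernel_DERIV:
  assumes "\<tau> > 0"
  shows "(heat_kernel \<tau> has_real_derivative heat_kernel_x \<tau> x) (at x)"
proof -
  have "((\<lambda>x. - (x\<^sup>2 / (4 * \<tau>))) has_real_derivative - (x / (2 * \<tau>))) (at x)"
    using assms by (auto intro!: derivative_eq_intros)
  from DERIV_cdivide[OF DERIV_chain2[OF DERIV_exp this], of "sqrt (4 * pi * \<tau>)"]
  show ?thesis by (simp add: heat_kernel_def[abs_def] heat_kernel_x_def mult.commute)
qed

lemma heat_kernel_x_DERIV:
  assumes "\<tau> > 0"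
  shows "(heat_kernel_x \<tau> has_real_derivative heat_kernel_xx \<tau> x) (at x)"
proof -
  have "((\<lambda>x. - (x / (2 * \<tau>))) has_real_derivative - (1 / (2 * \<tau>))) (at x)"
    using assms by (auto intro!: derivative_eq_intros)
  from DERIV_mult[OF this heat_kernel_DERIV[OF assms]]
  have "(heat_kernel_x \<tau> has_real_derivative
      - (1 / (2 * \<tau>)) * heat_kernel \<tau> x + heat_kernel_x \<tau> x * - (x / (2 * \<tau>))) (at x)"
    by (simp only: heat_kernel_x_def[abs_def])
  also have "- (1 / (2 * \<tau>)) * heat_kernel \<tau> x + heat_kernel_x \<tau> x * - (x / (2 * \<tau>)) = heat_kernel_xx \<tau> x"
    by (simp add: heat_kernel_x_def heat_kernel_xx_def power2_eq_square left_diff_distrib)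
  finally show ?thesis .
qed

text \<open>The kernel solves the heat equation, so \<open>heat_kernel_xx\<close> doubles as its
  time derivative. The inner function \<open>g\<close> is there for affine diffusion times:
  increasing along \<open>\<phi>\<close>, decreasing in Duhamel's formula.\<close>

lemma heat_kernel_DERIV_time:
  assumes "g t > 0" "(g has_real_derivative g') (at t)"
  shows "((\<lambda>t. heat_kernel (g t) z) has_real_derivative heat_kernel_xx (g t) z * g') (at t)"
proof -
  define c where "c = g t"
  define S where "S = sqrt (4 * pi * c)"
  define E where "E = exp (- (z\<^sup>2 / (4 * c)))"
  have c: "c > 0" using assms by (simp add: c_def)
  then have S: "S > 0" "S * S = 4 * pi * c" by (auto simp: S_def)
  have "((\<lambda>\<tau>. exp (- (z\<^sup>2 / (4 * \<tau>)))) has_real_derivative E * (z\<^sup>2 / (4 * c\<^sup>2))) (at c)"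
    unfolding E_def using c
    by (auto intro!: derivative_eq_intros simp: power2_eq_square)
  moreover have "((\<lambda>\<tau>. sqrt (4 * pi * \<tau>)) has_real_derivative 2 * pi / S) (at c)"
    unfolding S_def using c
    by (auto intro!: derivative_eq_intros simp: field_simps zero_less_mult_iff mult_less_0_iff)
  ultimately have "((\<lambda>\<tau>. heat_kernel \<tau> z) has_real_derivative
      (E * (z\<^sup>2 / (4 * c\<^sup>2)) * S - E * (2 * pi / S)) / (S * S)) (at c)"
    unfolding heat_kernel_def E_def S_def using c by (intro DERIV_divide) auto
  also have "(E * (z\<^sup>2 / (4 * c\<^sup>2)) * S - E * (2 * pi / S)) / (S * S)
      = (z\<^sup>2 / (4 * c\<^sup>2)) * (E / S) - (2 * pi) / (S * S) * (E / S)"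
    using S(1) by (simp add: diff_divide_distrib mult_ac)
  also have "\<dots> = (z\<^sup>2 / (4 * c\<^sup>2) - 1 / (2 * c)) * (E / S)"
    unfolding S(2) left_diff_distrib by simp
  also have "\<dots> = heat_kernel_xx c z"
    by (simp add: heat_kernel_xx_def heat_kernel_def E_def S_def)
  finally have "((\<lambda>\<tau>. heat_kernel \<tau> z) has_real_derivative heat_kernel_xx (g t) z) (at (g t))"
    by (simp add: c_def)
  from DERIV_chain2[OF this assms(2)] show ?thesis by simp
qed

text \<open>Half of the Gaussian exponent absorbs the polynomial through 1 + r \<le> exp r; half of
  what remains pays for moving the centre by at most 1.\<close>

lemma one_add_square_mult_exp_le:
  fixes z w b :: real
  assumes "b > 0" "\<bar>z - w\<bar> \<le> 1"
  shows "(1 + z\<^sup>2) * exp (- (z\<^sup>2 / (4 * b))) \<le> (1 + 8 * b) * exp (1 / (8 * b)) * exp (- (w\<^sup>2 / (16 * b)))"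
proof -
  have "1 + z\<^sup>2 \<le> (1 + 8 * b) * (1 + z\<^sup>2 / (8 * b))"
    using assms by (simp add: field_simps)
  also have "\<dots> \<le> (1 + 8 * b) * exp (z\<^sup>2 / (8 * b))"
    using assms by (intro mult_left_mono exp_ge_add_one_self) auto
  finally have "(1 + z\<^sup>2) * exp (- (z\<^sup>2 / (4 * b)))
      \<le> (1 + 8 * b) * exp (z\<^sup>2 / (8 * b)) * exp (- (z\<^sup>2 / (4 * b)))"
    by (intro mult_right_mono) auto
  also have "\<dots> = (1 + 8 * b) * exp (- (z\<^sup>2 / (8 * b)))"
    using assms by (simp add: exp_add[symmetric] field_simps)
  also have "\<dots> \<le> (1 + 8 * b) * (exp (1 / (8 * b)) * exp (- (w\<^sup>2 / (16 * b))))"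
  proof -
    have "(z - w)\<^sup>2 \<le> 1" using assms by (simp add: abs_square_le_1)
    \<comment> \<open>Used with the identity \<open>w\<^sup>2 + (2 * z - w)\<^sup>2 = 2 * z\<^sup>2
      + 2 * (z - w)\<^sup>2\<close>.\<close>
    moreover have "0 \<le> (2 * z - w)\<^sup>2" by simp
    ultimately have "w\<^sup>2 \<le> 2 * z\<^sup>2 + 2" by (simp add: power2_eq_square algebra_simps)
    then have "- (z\<^sup>2 / (8 * b)) \<le> 1 / (8 * b) + - (w\<^sup>2 / (16 * b))"
      using assms by (simp add: field_simps)
    then show ?thesis using assms by (subst exp_add[symmetric]) simp
  qed
  finally show ?thesis by (simp add: mult.assoc)
qed

text \<open>One majorant serves all diffusion times in a compact interval and all \<open>x\<close>
  near \<open>x0\<close>, as differentiation under the integral requires: the largest time goes into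
  the exponent, the smallest into the prefactor. The weight 1 + z^2 is what the first two
  derivatives of the kernel cost.\<close>

lemma heat_kernel_dominated:
  assumes "0 < a" "a \<le> b"
  obtains g :: "real \<Rightarrow> real" where "integrable lborel g"
    "\<And>\<tau> x y. \<tau> \<in> {a..b} \<Longrightarrow> \<bar>x - x0\<bar> \<le> 1 \<Longrightarrow> (1 + (x - y)\<^sup>2) * heat_kernel \<tau> (x - y) \<le> g y"
proof
  define C where "C = (1 + 8 * b) * exp (1 / (8 * b)) / sqrt (4 * pi * a)"
  define g where "g y = C * exp (- ((x0 - y)\<^sup>2 / (16 * b)))" for y
  have b: "b > 0" using assms by simp
  have "integrable lborel (\<lambda>y. C * (sqrt (16 * pi * b) * normal_density x0 (sqrt (8 * b)) y))"
    using b by (intro integrable_mult_right) auto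
  also have "(\<lambda>y. C * (sqrt (16 * pi * b) * normal_density x0 (sqrt (8 * b)) y)) = g"
  proof
    fix y
    have "sqrt (2 * pi * (sqrt (8 * b))\<^sup>2) = sqrt (16 * pi * b)" using b by simp
    moreover have "2 * (sqrt (8 * b))\<^sup>2 = 16 * b" using b by simp
    ultimately show "C * (sqrt (16 * pi * b) * normal_density x0 (sqrt (8 * b)) y) = g y"
      using b by (simp only: normal_density_def g_def power2_commute[of y x0]) simp
  qed
  finally show "integrable lborel g" .
  fix \<tau> x y assume \<tau>: "\<tau> \<in> {a..b}" and x: "\<bar>x - x0\<bar> \<le> 1"
  have "heat_kernel \<tau> (x - y) \<le> exp (- ((x - y)\<^sup>2 / (4 * b))) / sqrt (4 * pi * a)"
    unfolding heat_kernel_def using \<tau> assms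
    by (intro frac_le) (auto intro!: divide_left_mono)
  then have "(1 + (x - y)\<^sup>2) * heat_kernel \<tau> (x - y)
      \<le> (1 + (x - y)\<^sup>2) * (exp (- ((x - y)\<^sup>2 / (4 * b))) / sqrt (4 * pi * a))"
    by (intro mult_left_mono) auto
  also have "\<dots> = (1 + (x - y)\<^sup>2) * exp (- ((x - y)\<^sup>2 / (4 * b))) / sqrt (4 * pi * a)"
    by simp
  also have "\<dots> \<le> (1 + 8 * b) * exp (1 / (8 * b)) * exp (- ((x0 - y)\<^sup>2 / (16 * b))) / sqrt (4 * pi * a)"
    using b x assms by (intro divide_right_mono one_add_square_mult_exp_le) auto
  finally show "(1 + (x - y)\<^sup>2) * heat_kernel \<tau> (x - y) \<le> g y" by (simp add: g_def C_def)
qed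

lemma heat_kernel_bounds:
  assumes "0 < a" "a \<le> \<tau>"
  shows "\<bar>heat_kernel \<tau> z\<bar> \<le> (1 + z\<^sup>2) * heat_kernel \<tau> z"
    and "\<bar>heat_kernel_x \<tau> z\<bar> \<le> (1 / a) * ((1 + z\<^sup>2) * heat_kernel \<tau> z)"
    and "\<bar>heat_kernel_xx \<tau> z\<bar> \<le> (1 / a\<^sup>2 + 1 / a) * ((1 + z\<^sup>2) * heat_kernel \<tau> z)"
proof -
  have K: "heat_kernel \<tau> z \<ge> 0" using assms by (simp add: heat_kernel_nonneg)
  show "\<bar>heat_kernel \<tau> z\<bar> \<le> (1 + z\<^sup>2) * heat_kernel \<tau> z"
    using K by (simp add: algebra_simps)
  have "\<bar>z\<bar> \<le> 1 + z\<^sup>2"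
    using zero_le_power2[of "\<bar>z\<bar> - 1"] by (simp add: power2_eq_square algebra_simps)
  then have "\<bar>z\<bar> / (2 * \<tau>) \<le> (1 + z\<^sup>2) / a"
    using assms by (intro frac_le) auto
  then show "\<bar>heat_kernel_x \<tau> z\<bar> \<le> (1 / a) * ((1 + z\<^sup>2) * heat_kernel \<tau> z)"
    using K assms mult_right_mono[of "\<bar>z\<bar> / (2 * \<tau>)" "(1 + z\<^sup>2) / a" "heat_kernel \<tau> z"]
    by (simp add: heat_kernel_x_def abs_mult)
  have "a\<^sup>2 \<le> \<tau>\<^sup>2" using assms by (intro power_mono) auto
  then have "a\<^sup>2 \<le> 4 * \<tau>\<^sup>2" using zero_le_power2[of \<tau>] by linarith
  then have 1: "z\<^sup>2 / (4 * \<tau>\<^sup>2) \<le> (1 + z\<^sup>2) / a\<^sup>2" using assms by (intro frac_le) auto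
  have 2: "1 / (2 * \<tau>) \<le> (1 + z\<^sup>2) / a" using assms by (intro frac_le) auto
  have "\<bar>z\<^sup>2 / (4 * \<tau>\<^sup>2) - 1 / (2 * \<tau>)\<bar> \<le> z\<^sup>2 / (4 * \<tau>\<^sup>2) + 1 / (2 * \<tau>)"
    using assms by (intro order.trans[OF abs_triangle_ineq4]) auto
  also have "\<dots> \<le> (1 / a\<^sup>2 + 1 / a) * (1 + z\<^sup>2)" using add_mono[OF 1 2] by (simp add: distrib_right)
  finally show "\<bar>heat_kernel_xx \<tau> z\<bar> \<le> (1 / a\<^sup>2 + 1 / a) * ((1 + z\<^sup>2) * heat_kernel \<tau> z)"
    using K by (simp add: heat_kernel_xx_def abs_mult mult.assoc[symmetric] mult_right_mono)
qed

lemma heat_kernel_integrable: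
  assumes "\<tau> > 0" and [measurable]: "f \<in> borel_measurable borel" and "\<And>y. \<bar>f y\<bar> \<le> M"
  shows "integrable lborel (\<lambda>y. heat_kernel \<tau> (x - y) * f y)"
    and "integrable lborel (\<lambda>y. heat_kernel_x \<tau> (x - y) * f y)"
    and "integrable lborel (\<lambda>y. heat_kernel_xx \<tau> (x - y) * f y)"
proof -
  obtain g where g: "integrable lborel g"
    "\<And>y. (1 + (x - y)\<^sup>2) * heat_kernel \<tau> (x - y) \<le> g y"
    using heat_kernel_dominated[of \<tau> \<tau> x] assms(1)
    by (metis (no_types, lifting) abs_zero atLeastAtMost_singleton diff_self insertI1 order_refl zero_le_one)
  have M: "M \<ge> 0" using assms(3)[of 0] by simp
  have dom: "integrable lborel (\<lambda>y. h y * f y)"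
    if [measurable]: "h \<in> borel_measurable borel" and "C \<ge> 0"
      "\<And>y. \<bar>h y\<bar> \<le> C * ((1 + (x - y)\<^sup>2) * heat_kernel \<tau> (x - y))" for h C
  proof (rule Bochner_Integration.integrable_bound)
    show "integrable lborel (\<lambda>y. C * g y * M)" using g by simp
    have "\<bar>h y * f y\<bar> \<le> C * g y * M" for y
      unfolding abs_mult using g(2)[of y] that M assms(3)[of y]
      by (intro mult_mono order.trans[OF that(3)[of y]] mult_left_mono) 
         (auto intro!: mult_nonneg_nonneg order.trans[OF _ g(2)[of y]] heat_kernel_nonneg assms)
    then show "AE y in lborel. norm (h y * f y) \<le> norm (C * g y * M)"
      by (auto intro!: AE_I2 intro: order.trans[OF _ abs_ge_self])
  qed measurable
  show "integrable lborel (\<lambda>y. heat_kernel \<tau> (x - y) * f y)"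
    using heat_kernel_bounds(1)[OF assms(1) order_refl] by (intro dom[of _ 1]) auto
  show "integrable lborel (\<lambda>y. heat_kernel_x \<tau> (x - y) * f y)"
    using heat_kernel_bounds(2)[OF assms(1) order_refl] assms(1) by (intro dom[of _ "1/\<tau>"]) auto
  show "integrable lborel (\<lambda>y. heat_kernel_xx \<tau> (x - y) * f y)"
    using heat_kernel_bounds(3)[OF assms(1) order_refl] assms(1)
    by (intro dom[of _ "1/\<tau>\<^sup>2 + 1/\<tau>"]) auto
qed

section \<open>Heat evolutions as averages over a standard normal variable\<close>

text \<open>The substitution \<open>y = x + sqrt (2 * \<tau>) * z\<close> moves the time from the
  singular kernel into the argument of \<open>f\<close>. The average is then over a fixed
  probability density, which includes \<open>\<tau> = 0\<close> and makes monotonicity, sup-norm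
  bounds and limits immediate.\<close>

lemma heat_std_normal:
  assumes "\<tau> \<ge> 0"
  shows "heat \<tau> f x = (\<integral>z. std_normal_density z * f (x + sqrt (2 * \<tau>) * z) \<partial>lborel)"
proof (cases "\<tau> = 0")
  case True
  then show ?thesis by (simp add: heat_def)
next
  case False
  then have \<tau>: "\<tau> > 0" using assms by simp
  let ?c = "sqrt (2 * \<tau>)"
  have "heat \<tau> f x = (\<integral>y. heat_kernel \<tau> (x - y) * f y \<partial>lborel)"
    using \<tau> by (simp add: heat_def)
  also have "\<dots> = \<bar>?c\<bar> *\<^sub>R (\<integral>z. heat_kernel \<tau> (x - (x + ?c * z)) * f (x + ?c * z) \<partial>lborel)"
    using \<tau> by (intro lborel_integral_real_affine) auto
  also have "\<dots> = (\<integral>z. ?c * (heat_kernel \<tau> (x - (x + ?c * z)) * f (x + ?c * z)) \<partial>lborel)"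
    using \<tau> by simp
  also have "(\<lambda>z. ?c * (heat_kernel \<tau> (x - (x + ?c * z)) * f (x + ?c * z)))
      = (\<lambda>z. std_normal_density z * f (x + ?c * z))"
  proof
    fix z
    have "?c * heat_kernel \<tau> (x - (x + ?c * z)) = std_normal_density z"
    proof -
      define c where "c = ?c"
      have "c > 0" using \<tau> by (simp add: c_def)
      then have "c * normal_density 0 c (- (c * z)) = std_normal_density z"
        by (simp add: normal_density_def real_sqrt_mult power_mult_distrib)
      then show ?thesis by (simp add: heat_kernel_normal[OF \<tau>] c_def)
    qed
    then show "?c * (heat_kernel \<tau> (x - (x + ?c * z)) * f (x + ?c * z)) = std_normal_density z * f (x + ?c * z)"
      by (metis mult.assoc)
  qed
  finally show ?thesis .
qed

lemma heat_normal_integrable: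
  assumes [measurable]: "f \<in> borel_measurable borel" and "\<And>y. \<bar>f y\<bar> \<le> M"
  shows "integrable lborel (\<lambda>z. std_normal_density z * f (x + c * z))"
proof (rule Bochner_Integration.integrable_bound)
  show "integrable lborel (\<lambda>z. std_normal_density z * M)" by simp
  show "AE z in lborel. norm (std_normal_density z * f (x + c * z)) \<le> norm (std_normal_density z * M)"
    using assms(2) by (auto simp: abs_mult intro!: AE_I2 mult_left_mono intro: order.trans[OF _ abs_ge_self])
qed measurable

lemma heat_mono:
  assumes "\<tau> \<ge> 0" "f \<in> borel_measurable borel" "\<And>y. \<bar>f y\<bar> \<le> M"
    "g \<in> borel_measurable borel" "\<And>y. \<bar>g y\<bar> \<le> N" "\<And>y. f y \<le> g y"
  shows "heat \<tau> f x \<le> heat \<tau> g x"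
  unfolding heat_std_normal[OF assms(1)]
  by (intro integral_mono heat_normal_integrable[OF assms(2,3)] heat_normal_integrable[OF assms(4,5)]
      mult_left_mono assms(6)) auto

lemma heat_const: "\<tau> \<ge> 0 \<Longrightarrow> heat \<tau> (\<lambda>_. c) x = c"
  by (simp add: heat_std_normal)

lemma heat_bound:
  assumes "\<tau> \<ge> 0" "f \<in> borel_measurable borel" "\<And>y. \<bar>f y\<bar> \<le> M"
  shows "\<bar>heat \<tau> f x\<bar> \<le> M"
proof -
  have "heat \<tau> f x \<le> heat \<tau> (\<lambda>_. M) x"
    using assms by (intro heat_mono[where M = M and N = "\<bar>M\<bar>"]) (auto simp: abs_le_iff)
  moreover have "heat \<tau> (\<lambda>_. - M) x \<le> heat \<tau> f x"
    using assms by (intro heat_mono[where N = M and M = "\<bar>M\<bar>"]) (auto simp: abs_le_iff minus_le_iff)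
  ultimately show ?thesis using assms(1) by (simp add: heat_const)
qed

lemma heat_periodic:
  assumes "\<tau> \<ge> 0" "circle_fun f"
  shows "circle_fun (heat \<tau> f)"
proof -
  have "f (x + 1 + c) = f (x + c)" for x c
    using assms(2)[unfolded circle_fun_def, rule_format, of "x + c"] by (simp add: algebra_simps)
  then show ?thesis using assms by (auto simp: circle_fun_def heat_std_normal)
qed

lemma heat_linear:
  assumes "\<tau> \<ge> 0" "f \<in> borel_measurable borel" "\<And>y. \<bar>f y\<bar> \<le> M"
    "g \<in> borel_measurable borel" "\<And>y. \<bar>g y\<bar> \<le> N"
  shows "heat \<tau> (\<lambda>y. a * f y + b * g y) x = a * heat \<tau> f x + b * heat \<tau> g x"
proof -
  note i = heat_normal_integrable[OF assms(2,3)] heat_normal_integrable[OF assms(4,5)]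
  show ?thesis unfolding heat_std_normal[OF assms(1)]
    using i[of x "sqrt (2 * \<tau>)"] by (simp add: algebra_simps)
qed

text \<open>Dominated convergence against the normal density. The time \<open>\<tau> s\<close> may
  vanish on \<open>A\<close>; this gives continuity of \<open>\<phi>\<close> down to
  \<open>t = 0\<close> and of the Duhamel interpolation up to \<open>s = t\<close>.\<close>

lemma heat_continuous_on:
  fixes f :: "real \<Rightarrow> real \<Rightarrow> real"
  assumes "\<And>s. s \<in> A \<Longrightarrow> \<tau> s \<ge> 0" "continuous_on A \<tau>"
    and f: "continuous_on (A \<times> UNIV) (\<lambda>(s, y). f s y)"
    and M: "\<And>s y. s \<in> A \<Longrightarrow> \<bar>f s y\<bar> \<le> M"
  shows "continuous_on (A \<times> UNIV) (\<lambda>(s, x). heat (\<tau> s) (f s) x)"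
proof (rule continuous_on_sequentiallyI)
  fix p :: "nat \<Rightarrow> real \<times> real" and q
  assume p: "\<forall>n. p n \<in> A \<times> UNIV" and q: "q \<in> A \<times> UNIV" and lim: "p \<longlonglongrightarrow> q"
  obtain s x where pq: "q = (s, x)" "s \<in> A" using q by auto
  have pA: "fst (p n) \<in> A" for n using p by (metis mem_Times_iff)
  have lims: "(\<lambda>n. fst (p n)) \<longlonglongrightarrow> s" "(\<lambda>n. snd (p n)) \<longlonglongrightarrow> x"
    using tendsto_fst[OF lim] tendsto_snd[OF lim] by (simp_all add: pq)
  have [measurable]: "f s \<in> borel_measurable borel" if "s \<in> A" for s
  proof -
    have "continuous_on UNIV (f s)"
      using that continuous_on_compose2[OF f, of UNIV "\<lambda>y. (s, y)"]
      by (simp add: continuous_on_Pair image_subset_iff)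
    then show ?thesis by (rule borel_measurable_continuous_onI)
  qed
  note meas = this
  have [measurable]: "f (fst (p n)) \<in> borel_measurable borel" for n using meas pA by blast
  have [measurable]: "f s \<in> borel_measurable borel" using meas pq by blast
  have "(\<lambda>n. heat (\<tau> (fst (p n))) (f (fst (p n))) (snd (p n))) \<longlonglongrightarrow> heat (\<tau> s) (f s) x"
    unfolding heat_std_normal[OF assms(1)[OF pA]] heat_std_normal[OF assms(1)[OF pq(2)]]
  proof (rule integral_dominated_convergence[where w = "\<lambda>z. std_normal_density z * M"])
    show "integrable lborel (\<lambda>z. std_normal_density z * M)" by simp
    show "AE z in lborel. norm (std_normal_density z * f (fst (p n)) (snd (p n) + sqrt (2 * \<tau> (fst (p n))) * z))
        \<le> std_normal_density z * M" for n
      using M[OF pA] by (auto simp: abs_mult intro!: AE_I2 mult_left_mono)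
    show "AE z in lborel. (\<lambda>n. std_normal_density z * f (fst (p n)) (snd (p n) + sqrt (2 * \<tau> (fst (p n))) * z))
        \<longlonglongrightarrow> std_normal_density z * f s (x + sqrt (2 * \<tau> s) * z)"
    proof (intro AE_I2 tendsto_mult_left)
      fix z
      have t: "(\<lambda>n. \<tau> (fst (p n))) \<longlonglongrightarrow> \<tau> s"
        using assms(2) lims(1) pA pq(2) by (auto simp: continuous_on_sequentially comp_def)
      have "(\<lambda>n. (fst (p n), snd (p n) + sqrt (2 * \<tau> (fst (p n))) * z)) \<longlonglongrightarrow> (s, x + sqrt (2 * \<tau> s) * z)"
        by (intro tendsto_intros lims t)
      then show "(\<lambda>n. f (fst (p n)) (snd (p n) + sqrt (2 * \<tau> (fst (p n))) * z)) \<longlonglongrightarrow> f s (x + sqrt (2 * \<tau> s) * z)"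
        using f[unfolded continuous_on_sequentially, rule_format, of "(s, x + sqrt (2 * \<tau> s) * z)"
          "\<lambda>n. (fst (p n), snd (p n) + sqrt (2 * \<tau> (fst (p n))) * z)"] pA pq(2)
        by (auto simp: comp_def)
    qed
  qed measurable
  then show "(\<lambda>n. case p n of (s, x) \<Rightarrow> heat (\<tau> s) (f s) x) \<longlonglongrightarrow> (case q of (s, x) \<Rightarrow> heat (\<tau> s) (f s) x)"
    by (simp add: pq case_prod_beta)
qed

section \<open>Space and time derivatives of heat evolutions\<close>

text \<open>The derivatives fall on the kernel, so \<open>f\<close> need only be bounded and
  measurable. This is the version for the nonlinear term of an arbitrary solution, whose regularity
  is not known beforehand.\<close>

lemma heat_DERIV_kernel:
  assumes \<tau>: "\<tau> > 0" and f: "f \<in> borel_measurable borel" "\<And>y. \<bar>f y\<bar> \<le> M"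
  shows "(heat \<tau> f has_real_derivative (\<integral>y. heat_kernel_x \<tau> (x - y) * f y \<partial>lborel)) (at x)"
    and "((\<lambda>x. \<integral>y. heat_kernel_x \<tau> (x - y) * f y \<partial>lborel) has_real_derivative
          (\<integral>y. heat_kernel_xx \<tau> (x - y) * f y \<partial>lborel)) (at x)"
proof -
  note [measurable] = f(1)
  obtain g where g: "integrable lborel g"
    "\<And>t x' y. t \<in> {\<tau>..\<tau>} \<Longrightarrow> \<bar>x' - x\<bar> \<le> 1 \<Longrightarrow> (1 + (x' - y)\<^sup>2) * heat_kernel t (x' - y) \<le> g y"
    using heat_kernel_dominated[OF \<tau> order_refl, of x] by blast
  have M: "M \<ge> 0" using f(2)[of 0] by simp
  have shift: "((\<lambda>x. x - y) has_real_derivative 1) (at t)" for y t :: real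
    by (auto intro!: derivative_eq_intros)
  have dom: "\<bar>h (x' - y) * f y\<bar> \<le> C * g y * M"
    if "\<And>z. \<bar>h z\<bar> \<le> C * ((1 + z\<^sup>2) * heat_kernel \<tau> z)" "\<bar>x' - x\<bar> < 1" "C \<ge> 0" for h C x' y
  proof -
    have "\<bar>h (x' - y)\<bar> \<le> C * g y"
      using that g(2)[of \<tau> x' y] by (intro order.trans[OF that(1)] mult_left_mono) auto
    then show ?thesis unfolding abs_mult using f(2)[of y] M by (intro mult_mono) auto
  qed
  have "((\<lambda>x. \<integral>y. heat_kernel \<tau> (x - y) * f y \<partial>lborel) has_real_derivative
      (\<integral>y. heat_kernel_x \<tau> (x - y) * f y \<partial>lborel)) (at x)"
  proof (rule has_real_derivative_lebesgue_integral[where e = 1 and g = "\<lambda>y. (1 / \<tau>) * g y * M"])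
    show "((\<lambda>x. heat_kernel \<tau> (x - y) * f y) has_real_derivative heat_kernel_x \<tau> (t - y) * f y) (at t)" for t y
      using DERIV_cmult_right[OF DERIV_chain2[OF heat_kernel_DERIV[OF \<tau>] shift[of y t]], where c = "f y"] by simp
    show "\<bar>heat_kernel_x \<tau> (t - y) * f y\<bar> \<le> (1 / \<tau>) * g y * M" if "\<bar>t - x\<bar> < 1" for t y
      using that \<tau> by (intro dom heat_kernel_bounds) auto
  qed (use g heat_kernel_integrable[OF \<tau> f] in auto)
  moreover have "heat \<tau> f = (\<lambda>x. \<integral>y. heat_kernel \<tau> (x - y) * f y \<partial>lborel)"
    using \<tau> by (auto simp: heat_def fun_eq_iff)
  ultimately show "(heat \<tau> f has_real_derivative (\<integral>y. heat_kernel_x \<tau> (x - y) * f y \<partial>lborel)) (at x)"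
    by simp
  show "((\<lambda>x. \<integral>y. heat_kernel_x \<tau> (x - y) * f y \<partial>lborel) has_real_derivative
      (\<integral>y. heat_kernel_xx \<tau> (x - y) * f y \<partial>lborel)) (at x)"
  proof (rule has_real_derivative_lebesgue_integral[where e = 1 and g = "\<lambda>y. (1 / \<tau>\<^sup>2 + 1 / \<tau>) * g y * M"])
    show "((\<lambda>x. heat_kernel_x \<tau> (x - y) * f y) has_real_derivative heat_kernel_xx \<tau> (t - y) * f y) (at t)" for t y
      using DERIV_cmult_right[OF DERIV_chain2[OF heat_kernel_x_DERIV[OF \<tau>] shift[of y t]], where c = "f y"] by simp
    show "\<bar>heat_kernel_xx \<tau> (t - y) * f y\<bar> \<le> (1 / \<tau>\<^sup>2 + 1 / \<tau>) * g y * M" if "\<bar>t - x\<bar> < 1" for t y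
      using that \<tau> by (intro dom heat_kernel_bounds) auto
  qed (use g heat_kernel_integrable[OF \<tau> f] in auto)
qed

lemma borel_measurable_DERIV:
  fixes f :: "real \<Rightarrow> real"
  assumes "\<And>x. (f has_real_derivative f' x) (at x)"
  shows "f \<in> borel_measurable borel"
  using assms by (intro borel_measurable_continuous_onI DERIV_continuous_on) auto

text \<open>Here the derivative falls on \<open>f\<close>, through the normal-density form; no
  negative power of \<open>\<tau>\<close> appears, and \<open>\<tau> = 0\<close> is
  included.\<close>

lemma heat_DERIV:
  assumes \<tau>: "\<tau> \<ge> 0" and der: "\<And>y. (f has_real_derivative f' y) (at y)"
    and [measurable]: "f' \<in> borel_measurable borel"
    and bound: "\<And>y. \<bar>f y\<bar> \<le> M" "\<And>y. \<bar>f' y\<bar> \<le> N"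
  shows "(heat \<tau> f has_real_derivative heat \<tau> f' x) (at x)"
proof -
  have f [measurable]: "f \<in> borel_measurable borel" by (rule borel_measurable_DERIV[OF der])
  have "((\<lambda>x. \<integral>z. std_normal_density z * f (x + sqrt (2 * \<tau>) * z) \<partial>lborel) has_real_derivative
      (\<integral>z. std_normal_density z * f' (x + sqrt (2 * \<tau>) * z) \<partial>lborel)) (at x)"
  proof (rule has_real_derivative_lebesgue_integral[where e = 1 and g = "\<lambda>z. std_normal_density z * N"])
    show "((\<lambda>x. std_normal_density z * f (x + sqrt (2 * \<tau>) * z)) has_real_derivative
        std_normal_density z * f' (t + sqrt (2 * \<tau>) * z)) (at t)" for t z
    proof -
      have "((\<lambda>x. x + sqrt (2 * \<tau>) * z) has_real_derivative 1) (at t)"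
        by (auto intro!: derivative_eq_intros)
      from DERIV_cmult[OF DERIV_chain2[OF der this]] show ?thesis by simp
    qed
    show "\<bar>std_normal_density z * f' (t + sqrt (2 * \<tau>) * z)\<bar> \<le> std_normal_density z * N" for t z
      using bound(2) by (auto simp: abs_mult intro!: mult_left_mono)
  qed (use heat_normal_integrable[OF f bound(1)] in auto)
  moreover have "heat \<tau> h = (\<lambda>x. \<integral>z. std_normal_density z * h (x + sqrt (2 * \<tau>) * z) \<partial>lborel)" for h
    using heat_std_normal[OF \<tau>] by blast
  ultimately show ?thesis by simp
qed

text \<open>Integration by parts: the two formulas for the derivative of a heat evolution, with the
  derivative on the kernel and on the function, must agree.\<close>

lemma heat_kernel_xx_integral:
  assumes \<tau>: "\<tau> > 0" and der: "\<And>y. (f has_real_derivative f' y) (at y)" "\<And>y. (f' has_real_derivative f'' y) (at y)"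
    and meas: "f'' \<in> borel_measurable borel"
    and bound: "\<And>y. \<bar>f y\<bar> \<le> M" "\<And>y. \<bar>f' y\<bar> \<le> N" "\<And>y. \<bar>f'' y\<bar> \<le> L"
  shows "(\<integral>y. heat_kernel_xx \<tau> (x - y) * f y \<partial>lborel) = heat \<tau> f'' x"
proof -
  have \<tau>': "\<tau> \<ge> 0" using \<tau> by simp
  have eq: "(\<lambda>x. \<integral>y. heat_kernel_x \<tau> (x - y) * f y \<partial>lborel) = heat \<tau> f'"
    using heat_DERIV_kernel(1)[OF \<tau> borel_measurable_DERIV[OF der(1)] bound(1)]
      heat_DERIV[OF \<tau>' der(1) borel_measurable_DERIV[OF der(2)] bound(1,2)]
    by (intro ext) (rule DERIV_unique)
  from heat_DERIV_kernel(2)[OF \<tau> borel_measurable_DERIV[OF der(1)] bound(1)] show ?thesis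
    unfolding eq using heat_DERIV[OF \<tau>' der(2) meas bound(2,3)] by (rule DERIV_unique)
qed

text \<open>A product rule: the time derivative of the kernel is its second space derivative, which
  integration by parts moves onto \<open>v\<close>. With \<open>\<beta> = \<nu>\<close> it yields
  the heat equation for \<open>\<phi>\<close>, with \<open>\<beta> = - \<nu>\<close> the derivative
  of the Duhamel interpolation.\<close>

lemma heat_DERIV_time:
  fixes v vt :: "real \<Rightarrow> real \<Rightarrow> real"
  assumes e: "e > 0" and pos: "\<alpha> + \<beta> * s0 > 0"
    and der: "\<And>s y. \<bar>s - s0\<bar> < e \<Longrightarrow> ((\<lambda>s. v s y) has_real_derivative vt s y) (at s)"
    and meas: "\<And>s. \<bar>s - s0\<bar> < e \<Longrightarrow> v s \<in> borel_measurable borel" "vt s0 \<in> borel_measurable borel"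
    and bound: "\<And>s y. \<bar>s - s0\<bar> < e \<Longrightarrow> \<bar>v s y\<bar> \<le> M" "\<And>s y. \<bar>s - s0\<bar> < e \<Longrightarrow> \<bar>vt s y\<bar> \<le> N"
    and derx: "\<And>y. (v s0 has_real_derivative vx y) (at y)" "\<And>y. (vx has_real_derivative vxx y) (at y)"
    and measx: "vxx \<in> borel_measurable borel"
    and boundx: "\<And>y. \<bar>vx y\<bar> \<le> K" "\<And>y. \<bar>vxx y\<bar> \<le> L"
  shows "((\<lambda>s. heat (\<alpha> + \<beta> * s) (v s) x) has_real_derivative
    heat (\<alpha> + \<beta> * s0) (\<lambda>y. \<beta> * vxx y + 1 * vt s0 y) x) (at s0)"
proof -
  define \<tau>0 where "\<tau>0 = \<alpha> + \<beta> * s0"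
  \<comment> \<open>Within distance \<open>d\<close> the diffusion time changes by at most
    \<open>\<tau>0 / 2\<close>, so a single majorant applies; the \<open>+ 1\<close> keeps the
    quotient positive when \<open>\<beta> = 0\<close>.\<close>
  define d where "d = min e (\<tau>0 / (2 * (\<bar>\<beta>\<bar> + 1)))"
  have \<tau>0: "\<tau>0 > 0" using pos by (simp add: \<tau>0_def)
  have d: "d > 0" using e \<tau>0 by (simp add: d_def)
  have near: "\<bar>s - s0\<bar> < e" "\<alpha> + \<beta> * s \<in> {\<tau>0 / 2..2 * \<tau>0}" if "\<bar>s - s0\<bar> < d" for s
  proof -
    show "\<bar>s - s0\<bar> < e" using that by (simp add: d_def)
    have "\<bar>\<beta> * (s - s0)\<bar> \<le> (\<bar>\<beta>\<bar> + 1) * (\<tau>0 / (2 * (\<bar>\<beta>\<bar> + 1)))"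
      unfolding abs_mult using that \<tau>0 by (intro mult_mono) (auto simp: d_def)
    also have "\<dots> = \<tau>0 / 2"
    proof -
      have "\<bar>\<beta>\<bar> + 1 \<noteq> 0" by linarith
      then show ?thesis by (metis nonzero_mult_divide_mult_cancel_left mult.commute times_divide_eq_right)
    qed
    finally have "\<bar>\<beta> * (s - s0)\<bar> \<le> \<tau>0 / 2" .
    moreover have "\<alpha> + \<beta> * s = \<tau>0 + \<beta> * (s - s0)" by (simp add: \<tau>0_def algebra_simps)
    ultimately show "\<alpha> + \<beta> * s \<in> {\<tau>0 / 2..2 * \<tau>0}" using \<tau>0 by auto
  qed
  have s0: "\<bar>s0 - s0\<bar> < e" using e by simp
  note [measurable] = meas(2) meas(1)[OF s0]
  have M: "M \<ge> 0" "N \<ge> 0" using bound[OF s0, of 0] by auto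
  obtain g where g: "integrable lborel g"
    "\<And>t x' y. t \<in> {\<tau>0/2..2*\<tau>0} \<Longrightarrow> \<bar>x' - x\<bar> \<le> 1 \<Longrightarrow> (1 + (x' - y)\<^sup>2) * heat_kernel t (x' - y) \<le> g y"
    using heat_kernel_dominated[of "\<tau>0/2" "2*\<tau>0" x] \<tau>0 by auto
  define C where "C = 1 / (\<tau>0 / 2)\<^sup>2 + 1 / (\<tau>0 / 2)"
  have C: "C \<ge> 0" using \<tau>0 by (simp add: C_def)
  have "((\<lambda>s. \<integral>y. heat_kernel (\<alpha> + \<beta> * s) (x - y) * v s y \<partial>lborel) has_real_derivative
      (\<integral>y. heat_kernel_xx (\<alpha> + \<beta> * s0) (x - y) * \<beta> * v s0 y + vt s0 y * heat_kernel (\<alpha> + \<beta> * s0) (x - y) \<partial>lborel)) (at s0)"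
  proof (rule has_real_derivative_lebesgue_integral[where e = d and g = "\<lambda>y. C * g y * \<bar>\<beta>\<bar> * M + N * g y"])
    fix s y assume s: "\<bar>s - s0\<bar> < d"
    note n = near[OF s]
    then have p: "\<alpha> + \<beta> * s > 0" using \<tau>0 by auto
    show "integrable lborel (\<lambda>y. heat_kernel (\<alpha> + \<beta> * s) (x - y) * v s y)"
      using heat_kernel_integrable(1)[OF p meas(1) bound(1)] n(1) by blast
    have "((\<lambda>s. \<alpha> + \<beta> * s) has_real_derivative \<beta>) (at s)"
      by (auto intro!: derivative_eq_intros)
    from DERIV_mult[OF heat_kernel_DERIV_time[OF p this] der[OF n(1)]]
    show "((\<lambda>s. heat_kernel (\<alpha> + \<beta> * s) (x - y) * v s y) has_real_derivative
      heat_kernel_xx (\<alpha> + \<beta> * s) (x - y) * \<beta> * v s y + vt s y * heat_kernel (\<alpha> + \<beta> * s) (x - y)) (at s)" .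
    have t2: "0 < \<tau>0 / 2" "\<tau>0 / 2 \<le> \<alpha> + \<beta> * s" using n \<tau>0 by auto
    have gy: "(1 + (x - y)\<^sup>2) * heat_kernel (\<alpha> + \<beta> * s) (x - y) \<le> g y" using g(2)[OF n(2)] by simp
    have 1: "\<bar>heat_kernel_xx (\<alpha> + \<beta> * s) (x - y)\<bar> \<le> C * g y"
      unfolding C_def using gy C
      by (intro order.trans[OF heat_kernel_bounds(3)[OF t2]] mult_left_mono) (auto simp: C_def)
    have 2: "\<bar>heat_kernel (\<alpha> + \<beta> * s) (x - y)\<bar> \<le> g y"
      using gy by (intro order.trans[OF heat_kernel_bounds(1)[OF t2]])
    have "\<bar>heat_kernel_xx (\<alpha> + \<beta> * s) (x - y) * \<beta> * v s y\<bar> \<le> C * g y * \<bar>\<beta>\<bar> * M"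
      unfolding abs_mult using 1 bound(1)[OF n(1)] M
      by (intro mult_mono mult_right_mono) (auto intro: order.trans[OF _ 1])
    moreover have "\<bar>vt s y * heat_kernel (\<alpha> + \<beta> * s) (x - y)\<bar> \<le> N * g y"
      unfolding abs_mult using 2 bound(2)[OF n(1)] M by (intro mult_mono) auto
    ultimately show "\<bar>heat_kernel_xx (\<alpha> + \<beta> * s) (x - y) * \<beta> * v s y + vt s y * heat_kernel (\<alpha> + \<beta> * s) (x - y)\<bar>
        \<le> C * g y * \<bar>\<beta>\<bar> * M + N * g y"
      by (intro order.trans[OF abs_triangle_ineq]) linarith
  qed (use g d in auto)
  also have "(\<integral>y. heat_kernel_xx (\<alpha> + \<beta> * s0) (x - y) * \<beta> * v s0 y + vt s0 y * heat_kernel (\<alpha> + \<beta> * s0) (x - y) \<partial>lborel)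
    = (\<integral>y. \<beta> * (heat_kernel_xx (\<alpha> + \<beta> * s0) (x - y) * v s0 y) + heat_kernel (\<alpha> + \<beta> * s0) (x - y) * vt s0 y \<partial>lborel)"
    by (simp add: mult_ac)
  also have "\<dots> = \<beta> * (\<integral>y. heat_kernel_xx (\<alpha> + \<beta> * s0) (x - y) * v s0 y \<partial>lborel)
      + (\<integral>y. heat_kernel (\<alpha> + \<beta> * s0) (x - y) * vt s0 y \<partial>lborel)"
    using heat_kernel_integrable(3)[OF pos meas(1)[OF s0] bound(1)[OF s0], of x]
      heat_kernel_integrable(1)[OF pos meas(2) bound(2)[OF s0], of x] by simp
  also have "\<dots> = \<beta> * heat (\<alpha> + \<beta> * s0) vxx x + 1 * heat (\<alpha> + \<beta> * s0) (vt s0) x"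
    using heat_kernel_xx_integral[OF pos derx measx bound(1)[OF s0] boundx, of x] pos by (simp add: heat_def)
  also have "\<dots> = heat (\<alpha> + \<beta> * s0) (\<lambda>y. \<beta> * vxx y + 1 * vt s0 y) x"
    using pos by (intro heat_linear[OF _ measx boundx(2) meas(2) bound(2)[OF s0], symmetric]) simp
  finally have D: "((\<lambda>s. \<integral>y. heat_kernel (\<alpha> + \<beta> * s) (x - y) * v s y \<partial>lborel) has_real_derivative
      heat (\<alpha> + \<beta> * s0) (\<lambda>y. \<beta> * vxx y + 1 * vt s0 y) x) (at s0)" .
  have eq: "(\<integral>y. heat_kernel (\<alpha> + \<beta> * s) (x - y) * v s y \<partial>lborel) = heat (\<alpha> + \<beta> * s) (v s) x"
    if "s \<in> ball s0 d" for s
    using near(2)[of s] that \<tau>0 by (auto simp: dist_real_def heat_def abs_minus_commute)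
  show ?thesis
    using has_field_derivative_transform_within_open[OF D, of "ball s0 d"] eq d by auto
qed

section \<open>The gradient bound and its singular time integral\<close>

lemma heat_kernel_x_integral_bound:
  assumes \<tau>: "\<tau> > 0" and f [measurable]: "f \<in> borel_measurable borel" and M: "\<And>y. \<bar>f y\<bar> \<le> M"
  shows "\<bar>\<integral>y. heat_kernel_x \<tau> (x - y) * f y \<partial>lborel\<bar> \<le> M / sqrt \<tau>"
proof -
  have M0: "M \<ge> 0" using M[of 0] by simp
  define \<sigma> where "\<sigma> = sqrt (2 * \<tau>)"
  have \<sigma>: "\<sigma> > 0" "\<sigma>\<^sup>2 = 2 * \<tau>" using \<tau> by (auto simp: \<sigma>_def)
  have K: "heat_kernel \<tau> (x - y) = normal_density x \<sigma> y" for y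
    unfolding heat_kernel_normal[OF \<tau>] \<sigma>_def[symmetric] normal_density_def
    by (simp add: power2_commute)
  define C where "C = M / (4 * sqrt \<tau>)"
  define B where "B y = C * normal_density x \<sigma> y + C / \<tau> * (normal_density x \<sigma> y * (y - x)^2)" for y
  have B: "integrable lborel B" 
    unfolding B_def using integrable_normal_moment[OF \<sigma>(1), of x 2] \<sigma>
    by (intro Bochner_Integration.integrable_add integrable_mult_right) auto
  have le: "\<bar>heat_kernel_x \<tau> (x - y) * f y\<bar> \<le> B y" for y
  proof -
    define z where "z = \<bar>x - y\<bar>"
    \<comment> \<open>This is 2 r \<le> 1 + r^2 with r = z / sqrt \<tau>: it replaces the first
      absolute moment of the Gaussian by its variance. The resulting constant 3/4 is rounded up to
      1.\<close>
    have "0 \<le> (z / sqrt \<tau> - 1)\<^sup>2" by simp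
    also have "\<dots> = z\<^sup>2 / \<tau> - 2 * z / sqrt \<tau> + 1"
      using \<tau> by (simp add: power2_diff power_divide)
    finally have "2 * z / sqrt \<tau> \<le> 1 + z\<^sup>2 / \<tau>" by simp
    then have "2 * z / sqrt \<tau> / (4 * sqrt \<tau>) \<le> (1 + z\<^sup>2 / \<tau>) / (4 * sqrt \<tau>)"
      using \<tau> by (intro divide_right_mono) auto
    moreover have "2 * z / sqrt \<tau> / (4 * sqrt \<tau>) = z / (2 * \<tau>)"
      using \<tau> real_sqrt_mult_self[of \<tau>] by (simp add: mult.assoc[symmetric] del: real_sqrt_mult_self)
    ultimately have 1: "z / (2 * \<tau>) \<le> (1 + z\<^sup>2 / \<tau>) / (4 * sqrt \<tau>)" by metis
    have "\<bar>heat_kernel_x \<tau> (x - y) * f y\<bar> = z / (2 * \<tau>) * normal_density x \<sigma> y * \<bar>f y\<bar>"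
      using \<tau> by (simp add: heat_kernel_x_def K abs_mult z_def)
    also have "\<dots> \<le> (1 + z\<^sup>2 / \<tau>) / (4 * sqrt \<tau>) * normal_density x \<sigma> y * M"
      using 1 M[of y] \<tau> by (intro mult_mono mult_right_mono) auto
    also have "\<dots> = B y"
      by (simp add: B_def C_def z_def power2_commute[of x y] algebra_simps add_divide_distrib)
    finally show ?thesis .
  qed
  have "\<bar>\<integral>y. heat_kernel_x \<tau> (x - y) * f y \<partial>lborel\<bar> \<le> (\<integral>y. \<bar>heat_kernel_x \<tau> (x - y) * f y\<bar> \<partial>lborel)"
    by (rule integral_abs_bound)
  also have "\<dots> \<le> (\<integral>y. B y \<partial>lborel)"
    using le B heat_kernel_integrable(2)[OF \<tau> f M] by (intro integral_mono) auto
  also have "\<dots> = C + C / \<tau> * \<sigma>\<^sup>2"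
    unfolding B_def using \<sigma> integrable_normal_moment[OF \<sigma>(1), of x 2] integral_normal_moment_even[OF \<sigma>(1), of x 1]
    by (simp add: numeral_2_eq_2)
  also have "\<dots> = 3 * C" using \<tau> by (simp add: \<sigma>)
  also have "\<dots> \<le> M / sqrt \<tau>" using M0 \<tau> by (simp add: C_def field_simps)
  finally show ?thesis .
qed

text \<open>The integrand is unbounded at \<open>t\<close>, so the fundamental theorem is used in
  the form with one-sided limits of the antiderivative, which also yields integrability since the
  integrand is nonnegative.\<close>

lemma inverse_sqrt_integral:
  fixes a t :: real
  assumes "a < t"
  shows "set_integrable lborel {a<..<t} (\<lambda>s. 1 / sqrt (t - s))"
    and "(\<integral>s\<in>{a<..<t}. 1 / sqrt (t - s) \<partial>lborel) = 2 * sqrt (t - a)"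
proof -
  let ?F = "\<lambda>s. - 2 * sqrt (t - s)"
  have lim: "((?F \<circ> real_of_ereal) \<longlongrightarrow> ?F a) (at_right (ereal a))"
    "((?F \<circ> real_of_ereal) \<longlongrightarrow> ?F t) (at_left (ereal t))"
    unfolding ereal_tendsto_simps by (auto intro!: tendsto_eq_intros)
  have D: "DERIV ?F x :> 1 / sqrt (t - x)" if "x < t" for x
    using that by (auto intro!: derivative_eq_intros simp: field_simps)
  have C: "isCont (\<lambda>s. 1 / sqrt (t - s)) x" if "x < t" for x
    using that by (auto intro!: continuous_intros)
  have "set_integrable lborel (einterval (ereal a) (ereal t)) (\<lambda>s. 1 / sqrt (t - s))"
    "(LBINT s=ereal a..ereal t. 1 / sqrt (t - s)) = ?F t - ?F a"
    by (rule interval_integral_FTC_nonneg[where F = ?F]; use assms D C lim in auto)+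
  then show "set_integrable lborel {a<..<t} (\<lambda>s. 1 / sqrt (t - s))"
    "(\<integral>s\<in>{a<..<t}. 1 / sqrt (t - s) \<partial>lborel) = 2 * sqrt (t - a)"
    using assms by (auto simp: interval_lebesgue_integral_def)
qed

section \<open>Uniqueness of bounded Duhamel solutions\<close>

text \<open>Extension by zero turns measurability on the open half-plane into measurability for the
  product sigma-algebra, where slices and parametrised integrals are available.\<close>

lemma half_space_measurable:
  assumes "(\<lambda>(t, x). u t x :: real) \<in> borel_measurable (restrict_space borel ({(0::real)<..} \<times> (UNIV :: real set)))"
  shows "(\<lambda>p. indicator {0<..} (fst p) * u (fst p) (snd p)) \<in> borel_measurable (borel \<Otimes>\<^sub>M borel)"
proof -
  from assms have "(\<lambda>p. indicator ({0<..} \<times> UNIV) p *\<^sub>R (case p of (t, x) \<Rightarrow> u t x)) \<in> borel_measurable borel"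
    by (subst (asm) borel_measurable_restrict_space_iff) (auto intro!: borel_open open_Times)
  also have "(\<lambda>p. indicator ({0<..} \<times> UNIV) p *\<^sub>R (case p of (t, x) \<Rightarrow> u t x))
      = (\<lambda>p. indicator {0<..} (fst p) * u (fst p) (snd p))"
    by (auto simp: fun_eq_iff indicator_def)
  finally show ?thesis by (simp add: borel_prod)
qed

lemma half_space_measurable_slice:
  assumes "(\<lambda>(t, x). u t x :: real) \<in> borel_measurable (restrict_space borel ({(0::real)<..} \<times> (UNIV :: real set)))"
    "s > 0"
  shows "u s \<in> borel_measurable borel"
proof -
  note [measurable] = half_space_measurable[OF assms(1)]
  have "(\<lambda>y. (\<lambda>p. indicator {0<..} (fst p) * u (fst p) (snd p)) (s, y)) \<in> borel_measurable borel"
    by measurable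
  then show ?thesis using assms(2) by simp
qed

text \<open>Before two Duhamel formulas can be subtracted, their integrals must be known not to be
  default values. The gradient bound dominates the integrand by a multiple of
  \<open>1 / sqrt (t - s)\<close>; the kernel form makes it measurable in \<open>s\<close>.\<close>

lemma duhamel_integrand:
  assumes \<nu>: "\<nu> > 0"
    and sol: "(\<lambda>(t, x). u t x :: real) \<in> borel_measurable (restrict_space borel ({(0::real)<..} \<times> (UNIV :: real set)))"
    and M: "\<And>s y. 0 < s \<Longrightarrow> s < t \<Longrightarrow> \<bar>u s y\<bar> \<le> M"
  shows "0 < s \<Longrightarrow> s < t \<Longrightarrow> deriv (heat (\<nu> * (t - s)) (\<lambda>y. (u s y)\<^sup>2 / 2)) x
      = (\<integral>y. heat_kernel_x (\<nu> * (t - s)) (x - y) * ((u s y)\<^sup>2 / 2) \<partial>lborel)"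
    and "set_integrable lborel {0<..<t} (\<lambda>s. deriv (heat (\<nu> * (t - s)) (\<lambda>y. (u s y)\<^sup>2 / 2)) x)"
proof -
  define G where "G s = (\<integral>y. heat_kernel_x (\<nu> * (t - s)) (x - y) * ((u s y)\<^sup>2 / 2) \<partial>lborel)" for s
  have bd: "\<bar>(u s y)\<^sup>2 / 2\<bar> \<le> M\<^sup>2 / 2" if "0 < s" "s < t" for s y
    using power_mono[OF M[OF that, of y], of 2] by simp
  have meas: "(\<lambda>y. (u s y)\<^sup>2 / 2) \<in> borel_measurable borel" if "0 < s" for s
    using half_space_measurable_slice[OF sol that] by measurable
  have pos: "\<nu> * (t - s) > 0" if "s < t" for s using \<nu> that by simp
  show G: "deriv (heat (\<nu> * (t - s)) (\<lambda>y. (u s y)\<^sup>2 / 2)) x = G s" if "0 < s" "s < t" for s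
    unfolding G_def by (rule DERIV_imp_deriv[OF heat_DERIV_kernel(1)[OF pos[OF that(2)] meas[OF that(1)] bd[OF that]]])
  show "set_integrable lborel {0<..<t} (\<lambda>s. deriv (heat (\<nu> * (t - s)) (\<lambda>y. (u s y)\<^sup>2 / 2)) x)"
  proof (cases "t > 0")
    case True
    have "set_integrable lborel {0<..<t} (\<lambda>s. M\<^sup>2 / 2 / sqrt \<nu> * (1 / sqrt (t - s)))"
      using inverse_sqrt_integral(1)[OF True] by (rule set_integrable_mult_right)
    then have "set_integrable lborel {0<..<t} G"
    proof (rule set_integrable_bound)
      have [measurable]: "(\<lambda>p. indicator {0<..} (fst p) * u (fst p) (snd p)) \<in> borel_measurable (lborel \<Otimes>\<^sub>M lborel)"
        using half_space_measurable[OF sol]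
        by (subst measurable_cong_sets[OF sets_pair_measure_cong refl, of _ borel _ borel]) auto
      have [measurable]: "(\<lambda>p. heat_kernel_x (\<nu> * (t - fst p)) (x - snd p)) \<in> borel_measurable (lborel \<Otimes>\<^sub>M lborel)"
        unfolding heat_kernel_x_def heat_kernel_def by measurable
      have "(\<lambda>s. \<integral>y. indicator {0<..<t} s * (heat_kernel_x (\<nu> * (t - s)) (x - y) *
          ((indicator {0<..} s * u s y)\<^sup>2 / 2)) \<partial>lborel) \<in> borel_measurable lborel"
        by measurable
      also have "(\<lambda>s. \<integral>y. indicator {0<..<t} s * (heat_kernel_x (\<nu> * (t - s)) (x - y) *
          ((indicator {0<..} s * u s y)\<^sup>2 / 2)) \<partial>lborel) = (\<lambda>s. indicator {0<..<t} s *\<^sub>R G s)"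
        by (auto simp: fun_eq_iff G_def indicator_def)
      finally show "set_borel_measurable lborel {0<..<t} G" by (simp add: set_borel_measurable_def)
      show "AE s in lborel. s \<in> {0<..<t} \<longrightarrow> norm (G s) \<le> norm (M\<^sup>2 / 2 / sqrt \<nu> * (1 / sqrt (t - s)))"
      proof (intro AE_I2 impI)
        fix s assume "s \<in> {0<..<t}"
        then have s: "0 < s" "s < t" by auto
        have "\<bar>G s\<bar> \<le> M\<^sup>2 / 2 / sqrt (\<nu> * (t - s))"
          unfolding G_def by (rule heat_kernel_x_integral_bound[OF pos[OF s(2)] meas[OF s(1)] bd[OF s]])
        then show "norm (G s) \<le> norm (M\<^sup>2 / 2 / sqrt \<nu> * (1 / sqrt (t - s)))"
          using \<nu> s by (simp add: real_sqrt_mult)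
      qed
    qed
    then show ?thesis by (subst set_integrable_cong[OF refl refl G]) auto
  qed (simp add: set_integrable_def)
qed

text \<open>A contraction over time steps whose length \<open>\<delta>\<close> depends only on
  \<open>\<nu>\<close> and the common bound \<open>M\<close>, so that finitely many steps reach
  \<open>t\<close>. Within a step the difference is halved repeatedly, starting from the crude bound
  \<open>2 * M\<close>.\<close>

lemma burgers_solution_unique:
  assumes \<nu>: "\<nu> > 0" and sol: "burgers_solution \<nu> u0 u" "burgers_solution \<nu> u0 v" and t: "t \<ge> 0"
  shows "u t x = v t x"
proof -
  have meas: "(\<lambda>(t, x). u t x) \<in> borel_measurable (restrict_space borel ({0<..} \<times> UNIV))"
    "(\<lambda>(t, x). v t x) \<in> borel_measurable (restrict_space borel ({0<..} \<times> UNIV))"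
    using sol by (simp_all add: burgers_solution_def)
  \<comment> \<open>Strictly larger than \<open>t\<close>, since solutions are bounded on open time
    intervals by definition.\<close>
  define T where "T = t + 1"
  have T: "T > 0" using t by (simp add: T_def)
  obtain M1 M2 where M12: "\<And>s y. 0 < s \<Longrightarrow> s < T \<Longrightarrow> \<bar>u s y\<bar> \<le> M1" "\<And>s y. 0 < s \<Longrightarrow> s < T \<Longrightarrow> \<bar>v s y\<bar> \<le> M2"
    using sol T unfolding burgers_solution_def by (metis greaterThanLessThan_iff)
  define M where "M = max M1 M2"
  have M: "\<bar>u s y\<bar> \<le> M" "\<bar>v s y\<bar> \<le> M" if "0 < s" "s < T" for s y
    using M12[OF that, of y] by (auto simp: M_def)
  have M0: "M \<ge> 0" using M(1)[of "T/2" 0] T by simp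
  \<comment> \<open>Chosen so that the integral of \<open>M / sqrt (\<nu> * (t - s))\<close> over a
    full step ending at \<open>t\<close> is \<open>M / (2 * (M + 1))\<close>, at most 1/2; the
    \<open>+ 1\<close> covers \<open>M = 0\<close>.\<close>
  define \<delta> where "\<delta> = \<nu> / (4 * (M + 1))\<^sup>2"
  have \<delta>: "\<delta> > 0" using \<nu> M0 by (auto simp: \<delta>_def)
  have \<delta>2: "M * (2 * sqrt \<delta>) / sqrt \<nu> \<le> 1 / 2"
  proof -
    have "sqrt \<delta> = sqrt \<nu> / (4 * (M + 1))" using M0 by (simp add: \<delta>_def real_sqrt_divide)
    then have "M * (2 * sqrt \<delta>) / sqrt \<nu> = M * 2 / (4 * M + 4)" using \<nu> by simp
    also have "\<dots> \<le> 1 / 2" using M0 by (simp add: divide_le_eq)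
    finally show ?thesis .
  qed
  have eq: "u t x = heat (\<nu> * t) u0 x
        - (\<integral>s\<in>{0<..<t}. deriv (heat (\<nu> * (t - s)) (\<lambda>y. (u s y)\<^sup>2 / 2)) x \<partial>lborel)"
     "v t x = heat (\<nu> * t) u0 x
        - (\<integral>s\<in>{0<..<t}. deriv (heat (\<nu> * (t - s)) (\<lambda>y. (v s y)\<^sup>2 / 2)) x \<partial>lborel)" if "t \<ge> 0" for t x
    using sol that unfolding burgers_solution_def by blast+
  \<comment> \<open>Up to \<open>A\<close> the two integrands agree and cancel. Beyond
    \<open>A\<close> the factorisation of \<open>u\<^sup>2 - v\<^sup>2\<close> gives the bound
    \<open>2 * M * D\<close>, to which the gradient bound applies.\<close>
  have halve: "\<bar>u t x - v t x\<bar> \<le> D / 2"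
    if A: "A \<ge> 0" "A < t" "t \<le> A + \<delta>" "t < T" and same: "\<And>s y. 0 \<le> s \<Longrightarrow> s \<le> A \<Longrightarrow> u s y = v s y"
      and D: "\<And>s y. A < s \<Longrightarrow> s \<le> A + \<delta> \<Longrightarrow> s < T \<Longrightarrow> \<bar>u s y - v s y\<bar> \<le> D" for A t x D
  proof -
    define U where "U s = deriv (heat (\<nu> * (t - s)) (\<lambda>y. (u s y)\<^sup>2 / 2)) x" for s
    define V where "V s = deriv (heat (\<nu> * (t - s)) (\<lambda>y. (v s y)\<^sup>2 / 2)) x" for s
    have D0: "D \<ge> 0" using D[of t 0] A by (meson abs_ge_zero order_trans)
    have Mu: "\<bar>u s y\<bar> \<le> M" and Mv: "\<bar>v s y\<bar> \<le> M" if "0 < s" "s < t" for s y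
      using M[of s y] that A by auto
    note int = duhamel_integrand(2)[OF \<nu> meas(1) Mu, of t x, folded U_def]
      duhamel_integrand(2)[OF \<nu> meas(2) Mv, of t x, folded V_def]
    have "u t x - v t x = - ((\<integral>s\<in>{0<..<t}. U s \<partial>lborel) - (\<integral>s\<in>{0<..<t}. V s \<partial>lborel))"
      using A by (simp add: eq U_def V_def)
    also have "(\<integral>s\<in>{0<..<t}. U s \<partial>lborel) - (\<integral>s\<in>{0<..<t}. V s \<partial>lborel) = (\<integral>s\<in>{0<..<t}. U s - V s \<partial>lborel)"
      using int by (intro set_integral_diff(2)[symmetric]) auto
    finally have "\<bar>u t x - v t x\<bar> = \<bar>\<integral>s. indicator {0<..<t} s *\<^sub>R (U s - V s) \<partial>lborel\<bar>"
      by (simp add: set_lebesgue_integral_def)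
    also have "\<dots> \<le> (\<integral>s. indicator {A<..<t} s *\<^sub>R (M * D / sqrt \<nu> * (1 / sqrt (t - s))) \<partial>lborel)"
    proof (rule integral_abs_bound_integral)
      show "integrable lborel (\<lambda>s. indicator {0<..<t} s *\<^sub>R (U s - V s))"
        using set_integral_diff(1)[OF int] A by (simp add: set_integrable_def)
      show "integrable lborel (\<lambda>s. indicator {A<..<t} s *\<^sub>R (M * D / sqrt \<nu> * (1 / sqrt (t - s))))"
        using set_integrable_mult_right[where a = "M * D / sqrt \<nu>", OF inverse_sqrt_integral(1)[OF A(2)]]
        unfolding set_integrable_def .
      fix s :: real
      consider "s \<notin> {0<..<t}" | "0 < s" "s \<le> A" "s < t" | "A < s" "0 < s" "s < t" using A by force
      then show "\<bar>indicator {0<..<t} s *\<^sub>R (U s - V s)\<bar> \<le> indicator {A<..<t} s *\<^sub>R (M * D / sqrt \<nu> * (1 / sqrt (t - s)))"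
      proof cases
        case 1
        then show ?thesis using A by auto
      next
        case 2
        then have "u s = v s" using same[of s] by (auto simp: fun_eq_iff)
        then show ?thesis using 2 A by (simp add: U_def V_def)
      next
        case 3
        have \<tau>: "\<nu> * (t - s) > 0" using \<nu> 3 by simp
        have [measurable]: "u s \<in> borel_measurable borel" "v s \<in> borel_measurable borel"
          using half_space_measurable_slice[OF meas(1) 3(2)] half_space_measurable_slice[OF meas(2) 3(2)] by auto
        have b: "\<bar>(u s y)\<^sup>2 / 2\<bar> \<le> M\<^sup>2 / 2" "\<bar>(v s y)\<^sup>2 / 2\<bar> \<le> M\<^sup>2 / 2" for y
          using power_mono[OF Mu[OF 3(2,3), of y], of 2] power_mono[OF Mv[OF 3(2,3), of y], of 2] by auto
        have ii: "integrable lborel (\<lambda>y. heat_kernel_x (\<nu> * (t - s)) (x - y) * ((u s y)\<^sup>2 / 2))"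
          "integrable lborel (\<lambda>y. heat_kernel_x (\<nu> * (t - s)) (x - y) * ((v s y)\<^sup>2 / 2))"
          using heat_kernel_integrable(2)[OF \<tau> _ b(1)] heat_kernel_integrable(2)[OF \<tau> _ b(2)] by auto
        have UV: "U s = (\<integral>y. heat_kernel_x (\<nu> * (t - s)) (x - y) * ((u s y)\<^sup>2 / 2) \<partial>lborel)"
          "V s = (\<integral>y. heat_kernel_x (\<nu> * (t - s)) (x - y) * ((v s y)\<^sup>2 / 2) \<partial>lborel)"
          unfolding U_def V_def using 3 Mu Mv
          by (intro duhamel_integrand(1)[OF \<nu> meas(1)] duhamel_integrand(1)[OF \<nu> meas(2)]; blast)+
        have "U s - V s = (\<integral>y. heat_kernel_x (\<nu> * (t - s)) (x - y) * ((u s y)\<^sup>2 / 2)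
            - heat_kernel_x (\<nu> * (t - s)) (x - y) * ((v s y)\<^sup>2 / 2) \<partial>lborel)"
          unfolding UV by (rule Bochner_Integration.integral_diff[OF ii, symmetric])
        also have "\<dots> = (\<integral>y. heat_kernel_x (\<nu> * (t - s)) (x - y) * (((u s y)\<^sup>2 - (v s y)\<^sup>2) / 2) \<partial>lborel)"
          by (simp add: right_diff_distrib diff_divide_distrib)
        also have "\<bar>\<dots>\<bar> \<le> M * D / sqrt (\<nu> * (t - s))"
        proof (rule heat_kernel_x_integral_bound[OF \<tau>])
          fix y
          have "\<bar>u s y + v s y\<bar> \<le> 2 * M" using Mu[OF 3(2,3), of y] Mv[OF 3(2,3), of y] by linarith
          moreover have "\<bar>u s y - v s y\<bar> \<le> D" using D[of s y] 3 A by auto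
          ultimately have "\<bar>u s y + v s y\<bar> * \<bar>u s y - v s y\<bar> \<le> 2 * M * D"
            using M0 by (intro mult_mono) auto
          moreover have "(u s y)\<^sup>2 - (v s y)\<^sup>2 = (u s y + v s y) * (u s y - v s y)"
            by (simp add: power2_eq_square algebra_simps)
          ultimately show "\<bar>((u s y)\<^sup>2 - (v s y)\<^sup>2) / 2\<bar> \<le> M * D" by (simp add: abs_mult)
        qed measurable
        finally show ?thesis using 3 \<nu> by (simp add: real_sqrt_mult)
      qed
    qed
    also have "\<dots> = M * D / sqrt \<nu> * (2 * sqrt (t - A))"
      by (simp only: set_lebesgue_integral_def[symmetric] set_integral_mult_right inverse_sqrt_integral(2)[OF A(2)])
    also have "\<dots> \<le> M * D / sqrt \<nu> * (2 * sqrt \<delta>)"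
      using A M0 D0 \<nu> by (intro mult_left_mono) auto
    also have "\<dots> = (M * (2 * sqrt \<delta>) / sqrt \<nu>) * D" by simp
    also have "\<dots> \<le> 1 / 2 * D" using D0 \<delta>2 by (intro mult_right_mono)
    finally show ?thesis by simp
  qed
  have "u s y = v s y" if "0 \<le> s" "s < T" "s \<le> real n * \<delta>" for n s y
    using that
  proof (induction n arbitrary: s y)
    case 0
    then show ?case using eq[of 0 y] by (simp add: set_lebesgue_integral_def)
  next
    case (Suc n)
    note IH = Suc.IH
    define A where "A = real n * \<delta>"
    have A: "A \<ge> 0" "real (Suc n) * \<delta> = A + \<delta>" using \<delta> by (auto simp: A_def algebra_simps)
    show ?case
    proof (cases "s \<le> A")
      case True
      then show ?thesis using Suc by (auto simp: A_def)
    next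
      case False
      have bound: "\<bar>u s y - v s y\<bar> \<le> 2 * M * (1 / 2) ^ k" if "A < s" "s \<le> A + \<delta>" "s < T" for k s y
        using that
      proof (induction k arbitrary: s y)
        case 0
        then show ?case using M[of s y] A(1) by (auto simp: abs_le_iff)
      next
        case (Suc k)
        have "\<bar>u s y - v s y\<bar> \<le> 2 * M * (1 / 2) ^ k / 2"
        proof (rule halve[of A])
          show "u s y = v s y" if "0 \<le> s" "s \<le> A" for s y
            using that IH[of s y] Suc.prems by (auto simp: A_def)
        qed (use Suc A(1) in auto)
        then show ?case by simp
      qed
      have "(\<lambda>k. 2 * M * (1 / 2) ^ k) \<longlonglongrightarrow> 2 * M * 0"
        by (intro tendsto_mult_left LIMSEQ_power_zero) auto
      then have "\<bar>u s y - v s y\<bar> \<le> 2 * M * 0"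
        using bound[of s y] Suc.prems False A(2) by (intro LIMSEQ_le_const) auto
      then show ?thesis by simp
    qed
  qed
  moreover obtain n where "t \<le> real n * \<delta>"
    using ex_less_of_nat_mult[OF \<delta>, of t] less_imp_le by auto
  ultimately show ?thesis using t by (auto simp: T_def)
qed

section \<open>The Cole-Hopf solution\<close>

lemma circle_fun_nat: "circle_fun f \<Longrightarrow> f (x + real n) = f x"
proof (induction n)
  case (Suc n)
  have "f (x + real n + 1) = f (x + real n)" using Suc.prems by (simp add: circle_fun_def)
  then show ?case using Suc by (simp add: add_ac)
qed simp

lemma circle_fun_frac:
  assumes "circle_fun f"
  shows "f x = f (frac x)"
proof (cases "x \<ge> 0")
  case True
  then show ?thesis using circle_fun_nat[OF assms, of "frac x" "nat \<lfloor>x\<rfloor>"] by (simp add: frac_def)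
next
  case False
  then show ?thesis using circle_fun_nat[OF assms, of x "nat (- \<lfloor>x\<rfloor>)"] by (simp add: frac_def)
qed

lemma circle_fun_attains_bounds:
  assumes "circle_fun f" "continuous_on UNIV f"
  obtains a b where "\<And>x. f a \<le> f x" "\<And>x. f x \<le> f b"
proof -
  have "continuous_on {0..1} f" using assms(2) continuous_on_subset by blast
  then obtain a b where "\<forall>x\<in>{0..1}. f a \<le> f x" "\<forall>x\<in>{0..1}. f x \<le> f b"
    using continuous_attains_inf[of "{0..1::real}" f] continuous_attains_sup[of "{0..1::real}" f] by auto
  moreover have "frac x \<in> {0..1}" for x :: real using frac_lt_1[of x] by auto
  ultimately show ?thesis using that[of a b] circle_fun_frac[OF assms(1)] by metis
qed

lemma circle_fun_DERIV:
  assumes "circle_fun f" "\<And>x. (f has_real_derivative f' x) (at x)"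
  shows "circle_fun f'"
  unfolding circle_fun_def
proof
  fix x
  have "((\<lambda>y. f (y + 1)) has_real_derivative f' (x + 1)) (at x)"
    using assms(2)[of "x + 1"] DERIV_shift by blast
  moreover have "(\<lambda>y. f (y + 1)) = f" using assms(1) by (simp add: circle_fun_def)
  ultimately show "f' (x + 1) = f' x" using assms(2)[of x] DERIV_unique by metis
qed

section \<open>Heat evolutions of the transformed datum\<close>

text \<open>\<open>f 0\<close> stands for the Cole-Hopf transform of the datum and
  \<open>f k\<close> for its \<open>k\<close>-th derivative. Order three is reached because
  \<open>uxx\<close> and \<open>ut\<close> contain the third derivative of
  \<open>\<phi> 0\<close>.\<close>

locale cole_hopf =
  fixes \<nu> :: real and f :: "nat \<Rightarrow> real \<Rightarrow> real"
  assumes nu: "\<nu> > 0"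
    and periodic: "circle_fun (f 0)"
    and pos: "\<And>x. f 0 x > 0"
    and deriv_f: "\<And>k x. k < 3 \<Longrightarrow> (f k has_real_derivative f (Suc k) x) (at x)"
    and cont_f3: "continuous_on UNIV (f 3)"
begin

lemma periodic_f: "k \<le> 3 \<Longrightarrow> circle_fun (f k)"
  by (induction k) (use periodic circle_fun_DERIV deriv_f in \<open>simp_all add: less_eq_Suc_le\<close>)

lemma cont_f: "k \<le> 3 \<Longrightarrow> continuous_on UNIV (f k)"
proof (cases "k = 3")
  case False
  moreover assume "k \<le> 3"
  ultimately show ?thesis using deriv_f[of k] by (intro DERIV_continuous_on) auto
qed (use cont_f3 in simp)

lemma meas_f: "k \<le> 3 \<Longrightarrow> f k \<in> borel_measurable borel"
  by (intro borel_measurable_continuous_onI cont_f)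

text \<open>\<open>C\<close> here and \<open>m\<close> below depend on \<open>f\<close>, hence on
  \<open>\<nu>\<close> in the application. They serve integrability, differentiability and
  boundedness at one fixed viscosity and never enter the final constant.\<close>

definition C :: real where "C = (SOME C. \<forall>k\<le>3. \<forall>x. \<bar>f k x\<bar> \<le> C)"

lemma bound_f: "k \<le> 3 \<Longrightarrow> \<bar>f k x\<bar> \<le> C"
proof -
  have "\<exists>B. \<forall>x. \<bar>f k x\<bar> \<le> B" if k: "k \<le> 3" for k
  proof -
    obtain a b where "\<And>x. f k a \<le> f k x" "\<And>x. f k x \<le> f k b"
      using circle_fun_attains_bounds[OF periodic_f[OF k] cont_f[OF k]] by blast
    then have "\<bar>f k x\<bar> \<le> \<bar>f k a\<bar> + \<bar>f k b\<bar>" for x by (smt (verit))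
    then show ?thesis by blast
  qed
  then obtain B where B: "\<And>k x. k \<le> 3 \<Longrightarrow> \<bar>f k x\<bar> \<le> B k" by metis
  have "\<forall>k\<le>3. \<forall>x. \<bar>f k x\<bar> \<le> Max (B ` {..3})"
    by (intro allI impI order.trans[OF B] Max_ge) auto
  then have "\<exists>C. \<forall>k\<le>3. \<forall>x. \<bar>f k x\<bar> \<le> C" by blast
  from someI_ex[OF this] show "k \<le> 3 \<Longrightarrow> \<bar>f k x\<bar> \<le> C" by (simp add: C_def)
qed

definition m :: real where "m = (SOME m. m > 0 \<and> (\<forall>x. m \<le> f 0 x))"

lemma m: "m > 0" "m \<le> f 0 x"
proof -
  obtain a b where "\<And>x. f 0 a \<le> f 0 x" "\<And>x. f 0 x \<le> f 0 b"
    using circle_fun_attains_bounds[OF periodic_f[of 0] cont_f[of 0]] by auto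
  then have "\<exists>m. m > 0 \<and> (\<forall>x. m \<le> f 0 x)" using pos by blast
  from someI_ex[OF this] show "m > 0" "m \<le> f 0 x" by (simp_all add: m_def)
qed

definition \<phi> :: "nat \<Rightarrow> real \<Rightarrow> real \<Rightarrow> real" where "\<phi> k t = heat (\<nu> * t) (f k)"

lemma \<phi>_bound: "t \<ge> 0 \<Longrightarrow> k \<le> 3 \<Longrightarrow> \<bar>\<phi> k t x\<bar> \<le> C"
  unfolding \<phi>_def using nu by (intro heat_bound meas_f bound_f) auto

lemma \<phi>_lower:
  assumes "t \<ge> 0"
  shows "\<phi> 0 t x \<ge> m"
proof -
  have "heat (\<nu> * t) (\<lambda>_. m) x \<le> heat (\<nu> * t) (f 0) x"
    using nu assms m by (intro heat_mono[where M = m and N = C] bound_f meas_f) auto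
  then show ?thesis using nu assms by (simp add: heat_const \<phi>_def)
qed

lemma \<phi>_pos: "t \<ge> 0 \<Longrightarrow> \<phi> 0 t x > 0"
  using \<phi>_lower[of t x] m by simp

lemma \<phi>_periodic: "t \<ge> 0 \<Longrightarrow> k \<le> 3 \<Longrightarrow> \<phi> k t (x + 1) = \<phi> k t x"
  using heat_periodic[OF _ periodic_f, of "\<nu> * t" k] nu by (simp add: \<phi>_def circle_fun_def)

lemma \<phi>_DERIV:
  assumes "t \<ge> 0" "k < 3"
  shows "(\<phi> k t has_real_derivative \<phi> (Suc k) t x) (at x)"
  unfolding \<phi>_def using assms nu by (intro heat_DERIV[where M = C and N = C] deriv_f bound_f meas_f) auto

text \<open>The case of \<open>heat_DERIV_time\<close> for a family constant in time. The
  restriction on \<open>k\<close> reflects that two further derivatives of \<open>f k\<close> are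
  consumed.\<close>

lemma \<phi>_DERIV_time:
  assumes "t > 0" "k \<le> 1"
  shows "((\<lambda>t. \<phi> k t x) has_real_derivative \<nu> * \<phi> (k + 2) t x) (at t)"
proof -
  have "((\<lambda>t. heat (0 + \<nu> * t) ((\<lambda>_. f k) t) x) has_real_derivative
      heat (0 + \<nu> * t) (\<lambda>y. \<nu> * f (k + 2) y + 1 * (\<lambda>_ _. 0) t y) x) (at t)"
    using assms nu deriv_f[of k] deriv_f[of "Suc k"]
    by (intro heat_DERIV_time[where e = t and M = C and N = 0 and K = C and L = C and vx = "f (Suc k)"])
       (auto intro!: bound_f meas_f)
  moreover have "heat (\<nu> * t) (\<lambda>y. \<nu> * f (k + 2) y + 1 * 0) x = \<nu> * heat (\<nu> * t) (f (k + 2)) x + 1 * heat (\<nu> * t) (\<lambda>_. 0) x"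
    using assms nu by (intro heat_linear[where M = C and N = 0] meas_f bound_f) auto
  ultimately show ?thesis using nu assms by (simp add: \<phi>_def heat_const)
qed

lemma \<phi>_cont: "k \<le> 3 \<Longrightarrow> continuous_on ({0..} \<times> UNIV) (\<lambda>(t, x). \<phi> k t x)"
  unfolding \<phi>_def
proof (rule heat_continuous_on)
  assume k: "k \<le> 3"
  have "continuous_on ({0..} \<times> UNIV) (f k \<circ> snd)"
    by (intro continuous_on_compose continuous_intros continuous_on_subset[OF cont_f[OF k]]) auto
  then show "continuous_on ({0..} \<times> UNIV) (\<lambda>(s, y). f k y)" by (simp add: comp_def case_prod_beta)
  show "\<bar>f k y\<bar> \<le> C" for y using k by (rule bound_f)
qed (use nu in \<open>auto intro!: continuous_intros\<close>)

section \<open>Logarithmic derivatives and the Burgers equation\<close>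

text \<open>\<open>q 1\<close> is the logarithmic derivative of \<open>\<phi> 0\<close>.
  Differentiating a quotient gives a polynomial in such quotients, so the derivatives of
  \<open>u\<close> below are polynomials in \<open>q 1\<close>, \<open>q 2\<close>,
  \<open>q 3\<close> and inherit their continuity and bounds.\<close>

definition q :: "nat \<Rightarrow> real \<Rightarrow> real \<Rightarrow> real" where "q k t x = \<phi> k t x / \<phi> 0 t x"

lemma q_bound:
  assumes "t \<ge> 0" "k \<le> 3"
  shows "\<bar>q k t x\<bar> \<le> C / m"
  unfolding q_def abs_divide using \<phi>_bound[OF assms, of x] \<phi>_lower[OF assms(1), of x] m(1)
  by (intro frac_le) auto

lemma q_periodic: "t \<ge> 0 \<Longrightarrow> k \<le> 3 \<Longrightarrow> q k t (x + 1) = q k t x"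
  by (simp add: q_def \<phi>_periodic)

lemma q_DERIV:
  assumes "t \<ge> 0" "k < 3"
  shows "(q k t has_real_derivative q (Suc k) t x - q k t x * q 1 t x) (at x)"
proof -
  have "((\<lambda>x. \<phi> k t x / \<phi> 0 t x) has_real_derivative
      (\<phi> (Suc k) t x * \<phi> 0 t x - \<phi> k t x * \<phi> (Suc 0) t x) / (\<phi> 0 t x * \<phi> 0 t x)) (at x)"
    using \<phi>_pos[OF assms(1), of x] assms by (intro DERIV_divide \<phi>_DERIV) auto
  moreover have "(\<phi> (Suc k) t x * \<phi> 0 t x - \<phi> k t x * \<phi> (Suc 0) t x) / (\<phi> 0 t x * \<phi> 0 t x)
      = q (Suc k) t x - q k t x * q 1 t x"
    using \<phi>_pos[OF assms(1), of x] by (simp add: q_def diff_divide_distrib)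
  ultimately show ?thesis by (simp add: q_def[abs_def])
qed

lemma q_DERIV_time:
  assumes "t > 0" "k \<le> 1"
  shows "((\<lambda>t. q k t x) has_real_derivative \<nu> * (q (k + 2) t x - q k t x * q 2 t x)) (at t)"
proof -
  have "((\<lambda>t. \<phi> k t x / \<phi> 0 t x) has_real_derivative
      (\<nu> * \<phi> (k + 2) t x * \<phi> 0 t x - \<phi> k t x * (\<nu> * \<phi> (0 + 2) t x)) / (\<phi> 0 t x * \<phi> 0 t x)) (at t)"
    using \<phi>_pos[of t x] assms by (intro DERIV_divide \<phi>_DERIV_time) auto
  moreover have "(\<nu> * \<phi> (k + 2) t x * \<phi> 0 t x - \<phi> k t x * (\<nu> * \<phi> (0 + 2) t x)) / (\<phi> 0 t x * \<phi> 0 t x)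
      = \<nu> * (q (k + 2) t x - q k t x * q 2 t x)"
    using \<phi>_pos[of t x] assms by (simp add: q_def diff_divide_distrib right_diff_distrib numeral_2_eq_2)
  ultimately show ?thesis by (simp add: q_def[abs_def])
qed

lemma q_cont: "k \<le> 3 \<Longrightarrow> continuous_on ({0..} \<times> UNIV) (\<lambda>(t, x). q k t x)"
  unfolding q_def case_prod_beta
proof (rule continuous_on_divide)
  show "continuous_on ({0..} \<times> UNIV) (\<lambda>p. \<phi> k (fst p) (snd p))" if "k \<le> 3"
    using \<phi>_cont[OF that] by (simp add: case_prod_beta)
  show "continuous_on ({0..} \<times> UNIV) (\<lambda>p. \<phi> 0 (fst p) (snd p))"
    using \<phi>_cont[of 0] by (simp add: case_prod_beta)
  show "\<forall>p\<in>{0..} \<times> UNIV. \<phi> 0 (fst p) (snd p) \<noteq> 0"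
    using \<phi>_pos by (auto simp: less_imp_neq[symmetric])
qed

definition u :: "real \<Rightarrow> real \<Rightarrow> real" where "u t x = - 2 * \<nu> * q 1 t x"
definition ux :: "real \<Rightarrow> real \<Rightarrow> real" where "ux t x = - 2 * \<nu> * (q 2 t x - (q 1 t x)\<^sup>2)"
definition uxx :: "real \<Rightarrow> real \<Rightarrow> real" where
  "uxx t x = - 2 * \<nu> * (q 3 t x - 3 * q 1 t x * q 2 t x + 2 * q 1 t x ^ 3)"
definition ut :: "real \<Rightarrow> real \<Rightarrow> real" where
  "ut t x = - 2 * \<nu>\<^sup>2 * (q 3 t x - q 1 t x * q 2 t x)"

lemma u_periodic: "t \<ge> 0 \<Longrightarrow> circle_fun (u t)" "t \<ge> 0 \<Longrightarrow> circle_fun (ux t)"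
  by (simp_all add: circle_fun_def u_def ux_def q_periodic)

text \<open>A polynomial identity in the \<open>q k\<close>: the four definitions above result from
  formal use of \<open>q_DERIV\<close> and \<open>q_DERIV_time\<close>, and the next lemmas confirm
  that they are the derivatives of \<open>u\<close>.\<close>

lemma burgers: "ut t x + u t x * ux t x = \<nu> * uxx t x"
  by (simp add: ut_def u_def ux_def uxx_def algebra_simps power2_eq_square power3_eq_cube)

lemma u_DERIV: "t \<ge> 0 \<Longrightarrow> (u t has_real_derivative ux t x) (at x)"
  unfolding u_def ux_def using DERIV_cmult[OF q_DERIV[of t 1 x], of "- 2 * \<nu>"]
  by (simp add: numeral_2_eq_2 power2_eq_square)

lemma ux_DERIV: 
  assumes "t \<ge> 0"
  shows "(ux t has_real_derivative uxx t x) (at x)"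
proof -
  have three: "Suc 2 = (3 :: nat)" "Suc 1 = (2 :: nat)" "Suc (Suc (Suc 0)) = (3 :: nat)" "Suc (Suc 0) = (2 :: nat)" by simp_all
  note d = q_DERIV[OF assms, of 1 x] q_DERIV[OF assms, of 2 x]
  have "((\<lambda>x. - 2 * \<nu> * (q 2 t x - q 1 t x * q 1 t x)) has_real_derivative
    - 2 * \<nu> * ((q (Suc 2) t x - q 2 t x * q 1 t x)
      - ((q (Suc 1) t x - q 1 t x * q 1 t x) * q 1 t x + (q (Suc 1) t x - q 1 t x * q 1 t x) * q 1 t x))) (at x)"
    using d by (intro DERIV_cmult DERIV_diff DERIV_mult) auto
  also have "- 2 * \<nu> * ((q (Suc 2) t x - q 2 t x * q 1 t x)
      - ((q (Suc 1) t x - q 1 t x * q 1 t x) * q 1 t x + (q (Suc 1) t x - q 1 t x * q 1 t x) * q 1 t x)) = uxx t x"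
    unfolding three uxx_def power3_eq_cube by (simp only: algebra_simps)
  finally show ?thesis by (simp only: ux_def[abs_def] power2_eq_square)
qed

lemma u_DERIV_time:
  assumes "t > 0"
  shows "((\<lambda>t. u t x) has_real_derivative ut t x) (at t)"
  unfolding u_def ut_def using DERIV_cmult[OF q_DERIV_time[OF assms, of 1 x], of "- 2 * \<nu>"]
  by (simp add: power2_eq_square numeral_3_eq_3 numeral_2_eq_2 mult_ac)

lemma cont:
  shows u_cont: "continuous_on ({0..} \<times> UNIV) (\<lambda>(t, x). u t x)"
    and ux_cont: "continuous_on ({0..} \<times> UNIV) (\<lambda>(t, x). ux t x)"
    and "continuous_on ({0..} \<times> UNIV) (\<lambda>(t, x). uxx t x)"
    and ut_cont: "continuous_on ({0..} \<times> UNIV) (\<lambda>(t, x). ut t x)"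
proof -
  have [continuous_intros]: "continuous_on ({0..} \<times> UNIV) (\<lambda>p. q k (fst p) (snd p))" if "k \<le> 3" for k
    using q_cont[OF that] by (simp add: case_prod_beta)
  show "continuous_on ({0..} \<times> UNIV) (\<lambda>(t, x). u t x)" "continuous_on ({0..} \<times> UNIV) (\<lambda>(t, x). ux t x)"
    "continuous_on ({0..} \<times> UNIV) (\<lambda>(t, x). uxx t x)" "continuous_on ({0..} \<times> UNIV) (\<lambda>(t, x). ut t x)"
    unfolding u_def ux_def uxx_def ut_def case_prod_beta by (intro continuous_intros; simp)+
qed

lemma bounded_ex:
  obtains B where "\<And>t x. t \<ge> 0 \<Longrightarrow> \<bar>u t x\<bar> \<le> B" "\<And>t x. t \<ge> 0 \<Longrightarrow> \<bar>ux t x\<bar> \<le> B"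
    "\<And>t x. t \<ge> 0 \<Longrightarrow> \<bar>uxx t x\<bar> \<le> B" "\<And>t x. t \<ge> 0 \<Longrightarrow> \<bar>ut t x\<bar> \<le> B"
proof -
  define Q where "Q = C / m"
  have q: "\<bar>q k t x\<bar> \<le> Q" if "t \<ge> 0" "k \<le> 3" for k t x using q_bound[OF that] by (simp add: Q_def)
  have Q: "Q \<ge> 0" using q[of 0 0 0] by simp
  have q2: "\<bar>q 1 t x * q 1 t x\<bar> \<le> Q * Q" "\<bar>q 1 t x * q 2 t x\<bar> \<le> Q * Q"
    "\<bar>q 1 t x * q 1 t x * q 1 t x\<bar> \<le> Q * Q * Q" if "t \<ge> 0" for t x
    unfolding abs_mult using q[OF that] Q by (intro mult_mono; simp)+
  define B1 where "B1 = 2 * \<nu> * Q"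
  define B2 where "B2 = 2 * \<nu> * (Q + Q * Q)"
  define B3 where "B3 = 2 * \<nu> * (Q + 3 * (Q * Q) + 2 * (Q * Q * Q))"
  define B4 where "B4 = 2 * \<nu>\<^sup>2 * (Q + Q * Q)"
  define B where "B = max (max B1 B2) (max B3 B4)"
  have scale: "\<bar>- 2 * c * a\<bar> \<le> 2 * c * b" if "\<bar>a\<bar> \<le> b" "c > 0" for a b c :: real
    using that by (simp add: abs_mult)
  have "\<bar>u t x\<bar> \<le> B1" "\<bar>ux t x\<bar> \<le> B2" "\<bar>uxx t x\<bar> \<le> B3" "\<bar>ut t x\<bar> \<le> B4" if "t \<ge> 0" for t x
  proof -
    note b = q[OF that, of 1 x] q[OF that, of 2 x] q[OF that, of 3 x] q2[OF that, of x]
    show "\<bar>u t x\<bar> \<le> B1" unfolding u_def B1_def using b nu by (intro scale) auto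
    show "\<bar>ux t x\<bar> \<le> B2" unfolding ux_def B2_def power2_eq_square using b nu by (intro scale) linarith+
    show "\<bar>uxx t x\<bar> \<le> B3" unfolding uxx_def B3_def power3_eq_cube mult.assoc[of 3] using b nu
      by (intro scale) linarith+
    show "\<bar>ut t x\<bar> \<le> B4" unfolding ut_def B4_def using b nu by (intro scale) (linarith | simp)+
  qed
  then show ?thesis using that[of B] by (fastforce simp: B_def le_max_iff_disj)
qed

lemma u_slice_cont:
  assumes "t \<ge> 0"
  shows "continuous_on UNIV (u t)" "continuous_on UNIV (ux t)" "continuous_on UNIV (uxx t)" "continuous_on UNIV (ut t)"
proof -
  have *: "continuous_on UNIV (g t)" if "continuous_on ({0..} \<times> UNIV) (\<lambda>(t, x). g t x :: real)" for g :: "real \<Rightarrow> real \<Rightarrow> real"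
    using continuous_on_compose2[OF that, of UNIV "\<lambda>x. (t, x)"] assms
    by (simp add: continuous_on_Pair image_subset_iff)
  show "continuous_on UNIV (u t)" "continuous_on UNIV (ux t)" "continuous_on UNIV (uxx t)" "continuous_on UNIV (ut t)"
    by (rule *, rule cont)+
qed

text \<open>For fixed \<open>t\<close> and \<open>x\<close> the function \<open>F\<close> runs from
  the heat evolution of the datum at \<open>s = 0\<close> to \<open>u t x\<close> at
  \<open>s = t\<close>. Its derivative is the evolution of
  \<open>ut - \<nu> * uxx = - u * ux\<close>, that is, minus the space derivative of the evolved
  \<open>u\<^sup>2 / 2\<close>. Integrating in \<open>s\<close> gives Duhamel's formula.\<close>

lemma u_burgers_solution: "burgers_solution \<nu> (u 0) u"
  unfolding burgers_solution_def
proof (intro conjI allI impI)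
  obtain B where B: "\<And>t x. t \<ge> 0 \<Longrightarrow> \<bar>u t x\<bar> \<le> B" "\<And>t x. t \<ge> 0 \<Longrightarrow> \<bar>ux t x\<bar> \<le> B"
    "\<And>t x. t \<ge> 0 \<Longrightarrow> \<bar>uxx t x\<bar> \<le> B" "\<And>t x. t \<ge> 0 \<Longrightarrow> \<bar>ut t x\<bar> \<le> B" by (rule bounded_ex) blast
  have B0: "B \<ge> 0" using B(1)[of 0 0] by simp
  show "circle_fun (u t)" if "t \<ge> 0" for t using that by (rule u_periodic)
  show "\<exists>M. \<forall>t\<in>{0<..<T}. \<forall>x. \<bar>u t x\<bar> \<le> M" for T using B(1) by (intro exI[of _ B]) auto
  show meas: "(\<lambda>(t, x). u t x) \<in> borel_measurable (restrict_space borel ({0<..} \<times> UNIV))"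
    by (intro borel_measurable_continuous_on_restrict continuous_on_subset[OF u_cont]) auto
  have slice: "u s \<in> borel_measurable borel" "ux s \<in> borel_measurable borel"
    "uxx s \<in> borel_measurable borel" "ut s \<in> borel_measurable borel" if "s \<ge> 0" for s
    using u_slice_cont[OF that] by (auto intro: borel_measurable_continuous_onI)
  fix t x :: real assume t: "t \<ge> 0"
  define G where "G s = deriv (heat (\<nu> * (t - s)) (\<lambda>y. (u s y)\<^sup>2 / 2)) x" for s
  define F where "F s = heat (\<nu> * t + (- \<nu>) * s) (u s) x" for s
  have der: "(F has_real_derivative - G s) (at s)" if s: "0 < s" "s < t" for s
  proof -
    have pos: "\<nu> * t + (- \<nu>) * s > 0" using nu s by (simp add: mult_strict_left_mono)
    have near: "s' > 0" if "\<bar>s' - s\<bar> < s" for s' using that by linarith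
    have "(F has_real_derivative
        heat (\<nu> * t + (- \<nu>) * s) (\<lambda>y. (- \<nu>) * uxx s y + 1 * ut s y) x) (at s)"
      unfolding F_def
    proof (rule heat_DERIV_time[where vx = "ux s" and K = B and L = B, OF s(1) pos])
      show "((\<lambda>s. u s y) has_real_derivative ut s' y) (at s')" if "\<bar>s' - s\<bar> < s" for s' y
        using near[OF that] by (rule u_DERIV_time)
      show "u s' \<in> borel_measurable borel" if "\<bar>s' - s\<bar> < s" for s' using near[OF that] slice(1) by simp
      show "\<bar>u s' y\<bar> \<le> B" if "\<bar>s' - s\<bar> < s" for s' y using near[OF that] B(1) by simp
      show "\<bar>ut s' y\<bar> \<le> B" if "\<bar>s' - s\<bar> < s" for s' y using near[OF that] B(4) by simp
    qed (use s B slice u_DERIV ux_DERIV in auto)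
    moreover have "(\<lambda>y. (- \<nu>) * uxx s y + 1 * ut s y) = (\<lambda>y. (-1) * (u s y * ux s y) + 0 * 0)"
    proof
      fix y show "(- \<nu>) * uxx s y + 1 * ut s y = (-1) * (u s y * ux s y) + 0 * 0"
        using burgers[of s y] by simp
    qed
    moreover have "heat (\<nu> * t + (- \<nu>) * s) (\<lambda>y. (-1) * (u s y * ux s y) + 0 * 0) x
        = (-1) * heat (\<nu> * t + (- \<nu>) * s) (\<lambda>y. u s y * ux s y) x + 0 * heat (\<nu> * t + (- \<nu>) * s) (\<lambda>_. 0) x"
    proof (rule heat_linear)
      show "(\<lambda>y. u s y * ux s y) \<in> borel_measurable borel"
        using s slice[of s] by (intro borel_measurable_times) auto
      show "\<bar>u s y * ux s y\<bar> \<le> B * B" for y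
        unfolding abs_mult using s B(1,2)[of s y] B0 by (intro mult_mono) auto
    qed (use pos in auto)
    moreover have "(heat (\<nu> * t + (- \<nu>) * s) (\<lambda>y. (u s y)\<^sup>2 / 2) has_real_derivative
        heat (\<nu> * t + (- \<nu>) * s) (\<lambda>y. u s y * ux s y) x) (at x)"
    proof (rule heat_DERIV)
      show "((\<lambda>y. (u s y)\<^sup>2 / 2) has_real_derivative u s y * ux s y) (at y)" for y
        using u_DERIV[of s y] s by (auto intro!: derivative_eq_intros)
      show "(\<lambda>y. u s y * ux s y) \<in> borel_measurable borel"
        using s slice[of s] by (intro borel_measurable_times) auto
      show "\<bar>u s y * ux s y\<bar> \<le> B * B" for y
        unfolding abs_mult using s B(1,2)[of s y] B0 by (intro mult_mono) auto
      show "\<bar>(u s y)\<^sup>2 / 2\<bar> \<le> B\<^sup>2 / 2" for y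
        using power_mono[OF B(1)[of s y], of 2] s by simp
    qed (use pos in auto)
    then have "G s = heat (\<nu> * t + (- \<nu>) * s) (\<lambda>y. u s y * ux s y) x"
      unfolding G_def by (intro DERIV_imp_deriv) (simp add: algebra_simps)
    ultimately show ?thesis by simp
  qed
  \<comment> \<open>At \<open>s = t\<close> the diffusion time vanishes and only continuity of
    \<open>F\<close> is established, which is enough for the fundamental theorem with interior
    derivatives.\<close>
  have "continuous_on ({0..t} \<times> UNIV) (\<lambda>(s, x). heat (\<nu> * t + (- \<nu>) * s) (u s) x)"
  proof (rule heat_continuous_on)
    show "continuous_on ({0..t} \<times> UNIV) (\<lambda>(s, y). u s y)"
      by (rule continuous_on_subset[OF u_cont]) auto
    show "0 \<le> \<nu> * t + (- \<nu>) * s" if "s \<in> {0..t}" for s using that nu by simp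
  qed (use B(1) in \<open>auto intro!: continuous_intros\<close>)
  from continuous_on_compose2[OF this, of "{0..t}" "\<lambda>s. (s, x)"]
  have "continuous_on {0..t} F"
    by (simp add: F_def[abs_def] continuous_on_Pair image_subset_iff)
  then have "((\<lambda>s. - G s) has_integral (F t - F 0)) {0..t}"
    using der unfolding has_real_derivative_iff_has_vector_derivative
    by (intro fundamental_theorem_of_calculus_interior[OF t]) auto
  then have "(G has_integral (F 0 - F t)) {0..t}"
    using has_integral_neg[of "\<lambda>s. - G s" "F t - F 0" "{0..t}"] by simp
  then have "integral {0<..<t} G = F 0 - F t"
    by (simp add: has_integral_Icc_iff_Ioo integral_unique)
  moreover have "set_integrable lborel {0<..<t} G"
    unfolding G_def by (rule duhamel_integrand(2)[OF nu meas, where M = B]) (use B(1) in auto)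
  ultimately have "(\<integral>s\<in>{0<..<t}. G s \<partial>lborel) = F 0 - F t"
    by (simp add: set_borel_integral_eq_integral(2))
  moreover have "F t = u t x" by (simp add: F_def heat_def)
  ultimately show "u t x = heat (\<nu> * t) (u 0) x
      - (\<integral>s\<in>{0<..<t}. deriv (heat (\<nu> * (t - s)) (\<lambda>y. (u s y)\<^sup>2 / 2)) x \<partial>lborel)"
    by (simp add: F_def G_def)
qed

text \<open>By the Cauchy-Schwarz inequality for the heat kernel, \<open>\<phi> 0\<close> times a Gaussian is
  log-convex; this is Oleinik's one-sided bound.\<close>

lemma oleinik:
  assumes t: "t > 0"
  shows "ux t x \<le> 1 / t"
proof -
  define \<tau> where "\<tau> = \<nu> * t"
  have \<tau>: "\<tau> > 0" using nu t by (simp add: \<tau>_def)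
  define a where "a = q 1 t x"
  define k where "k y = heat_kernel \<tau> (x - y) * f 0 y" for y
  define r where "r y = (x - y) / (2 * \<tau>)" for y
  have f0: "f 0 \<in> borel_measurable borel" "\<And>y. \<bar>f 0 y\<bar> \<le> C" using meas_f bound_f by auto
  note i = heat_kernel_integrable[OF \<tau> f0, of x]
  have kx: "heat_kernel_x \<tau> (x - y) * f 0 y = - (r y * k y)" for y
    by (simp add: heat_kernel_x_def r_def k_def)
  \<comment> \<open>The last term, with its factor \<open>1 / (2 * \<tau>)\<close>, is the source of
    the right-hand side \<open>1 / t\<close>.\<close>
  have kxx: "heat_kernel_xx \<tau> (x - y) * f 0 y = (r y)\<^sup>2 * k y - 1 / (2 * \<tau>) * k y" for y
    by (simp add: heat_kernel_xx_def r_def k_def power_divide power_mult_distrib left_diff_distrib)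
  have ik: "integrable lborel k" using i(1) by (simp add: k_def[abs_def])
  have irk: "integrable lborel (\<lambda>y. r y * k y)" using integrable_minus[OF i(2)] by (simp add: kx)
  have irrk: "integrable lborel (\<lambda>y. (r y)\<^sup>2 * k y)"
    using Bochner_Integration.integrable_add[OF i(3) integrable_mult_right[OF ik, of "1 / (2 * \<tau>)"]]
    by (simp add: kxx)
  have 0: "(\<integral>y. k y \<partial>lborel) = \<phi> 0 t x" using nu t by (simp add: \<phi>_def heat_def k_def \<tau>_def)
  have 1: "(\<integral>y. r y * k y \<partial>lborel) = - \<phi> 1 t x"
  proof -
    have "(\<phi> 0 t has_real_derivative (\<integral>y. heat_kernel_x \<tau> (x - y) * f 0 y \<partial>lborel)) (at x)"
      using heat_DERIV_kernel(1)[OF \<tau> f0, of x] by (simp add: \<phi>_def \<tau>_def)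
    from DERIV_unique[OF this \<phi>_DERIV[of t 0 x]] t show ?thesis by (simp add: kx)
  qed
  have 2: "(\<integral>y. (r y)\<^sup>2 * k y \<partial>lborel) = \<phi> 2 t x + \<phi> 0 t x / (2 * \<tau>)"
  proof -
    have "(\<integral>y. heat_kernel_xx \<tau> (x - y) * f 0 y \<partial>lborel) = \<phi> 2 t x"
      unfolding \<phi>_def \<tau>_def[symmetric]
      by (rule heat_kernel_xx_integral[OF \<tau>, where f' = "f 1" and M = C and N = C and L = C])
         (use deriv_f[of 0] deriv_f[of 1] meas_f bound_f in \<open>auto simp: numeral_2_eq_2\<close>)
    then show ?thesis unfolding kxx using irrk ik 0 by simp
  qed
  \<comment> \<open>\<open>- a\<close> is the mean of \<open>r\<close> for the probability density
    \<open>k / \<phi> 0 t x\<close>, so this integral is \<open>\<phi> 0 t x\<close> times the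
    variance of \<open>r\<close>.\<close>
  have "0 \<le> (\<integral>y. (r y + a)\<^sup>2 * k y \<partial>lborel)"
    using pos heat_kernel_nonneg[OF \<tau>] by (intro integral_nonneg_AE AE_I2) (auto simp: k_def less_imp_le)
  also have "(\<lambda>y. (r y + a)\<^sup>2 * k y) = (\<lambda>y. (r y)\<^sup>2 * k y + (2 * a) * (r y * k y) + a\<^sup>2 * k y)"
    by (auto simp: fun_eq_iff power2_eq_square algebra_simps)
  also have "(\<integral>y. (r y)\<^sup>2 * k y + (2 * a) * (r y * k y) + a\<^sup>2 * k y \<partial>lborel)
      = \<phi> 2 t x + \<phi> 0 t x / (2 * \<tau>) + (2 * a) * (- \<phi> 1 t x) + a\<^sup>2 * \<phi> 0 t x"
    using ik irk irrk by (simp add: 0 1 2)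
  also have "\<dots> = \<phi> 0 t x * (q 2 t x - (q 1 t x)\<^sup>2 + 1 / (2 * \<tau>))"
    using \<phi>_pos[of t x] t by (simp add: a_def q_def field_simps power2_eq_square)
  finally have "0 \<le> q 2 t x - (q 1 t x)\<^sup>2 + 1 / (2 * \<tau>)"
    using \<phi>_pos[of t x] t by (simp add: zero_le_mult_iff)
  \<comment> \<open>The viscosity cancels: \<open>2 * \<nu> / (2 * \<tau>) = 1 / t\<close>.\<close>
  then have "2 * \<nu> * (- (q 2 t x - (q 1 t x)\<^sup>2)) \<le> 2 * \<nu> * (1 / (2 * \<tau>))"
    using nu by (intro mult_left_mono) auto
  then show ?thesis using nu t by (simp add: ux_def \<tau>_def right_diff_distrib)
qed

text \<open>Being the derivative of the periodic function
  \<open>- 2 * \<nu> * ln (\<phi> 0 t x)\<close>, \<open>u t\<close> vanishes at some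
  \<open>z\<close>. Oleinik's bound limits growth to the right only: a zero within distance 1 on the
  left bounds \<open>u\<close> from above, one on the right bounds it from below, and
  \<open>z\<close> with its shifts by 1 supplies both.\<close>

lemma u_bound_oleinik:
  assumes t: "t > 0" and x: "x \<in> {0..1}"
  shows "\<bar>u t x\<bar> \<le> 1 / t"
proof -
  have "((\<lambda>x. - 2 * \<nu> * ln (\<phi> 0 t x)) has_real_derivative u t x) (at x)" for x
  proof -
    have "((\<lambda>x. - 2 * \<nu> * ln (\<phi> 0 t x)) has_real_derivative - 2 * \<nu> * (1 / \<phi> 0 t x * \<phi> (Suc 0) t x)) (at x)"
      using t \<phi>_pos[of t x] by (intro DERIV_cmult DERIV_chain2[OF DERIV_ln_divide] \<phi>_DERIV) auto
    then show ?thesis by (simp add: u_def q_def)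
  qed
  note D = this
  have "\<exists>z>0. z < 1 \<and> - 2 * \<nu> * ln (\<phi> 0 t 1) - (- 2 * \<nu> * ln (\<phi> 0 t 0)) = (1 - 0) * u t z"
    by (rule MVT2) (use D in auto)
  then obtain z where z: "0 < z" "z < 1" "u t z = 0"
    using \<phi>_periodic[of t 0 0] t by auto
  have per: "u t (y + 1) = u t y" for y using u_periodic(1)[of t] t by (simp add: circle_fun_def)
  have lip: "u t b - u t a \<le> (b - a) / t" if "a \<le> b" for a b
  proof (cases "a = b")
    case False
    then have "a < b" using that by simp
    then obtain c where "u t b - u t a = (b - a) * ux t c"
      using MVT2[of a b "u t" "ux t"] u_DERIV[of t] t by force
    also have "\<dots> \<le> (b - a) * (1 / t)"
      using that oleinik[OF t, of c] by (intro mult_left_mono) auto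
    finally show ?thesis by simp
  qed simp
  have len: "(b - a) / t \<le> 1 / t" if "b - a \<le> 1" for a b
    using that t by (intro divide_right_mono) auto
  have zeros: "u t (z + 1) = 0" "u t (z - 1) = 0" using per[of z] per[of "z - 1"] z by auto
  show ?thesis
  proof (cases "x \<ge> z")
    case True
    then show ?thesis
      using lip[of z x] lip[of x "z + 1"] len[of x z] len[of "z + 1" x] x z zeros by auto
  next
    case False
    then show ?thesis
      using lip[of "z - 1" x] lip[of x z] len[of x "z - 1"] len[of z x] x z zeros by auto
  qed
qed

section \<open>Energy balance\<close>

definition energy :: "real \<Rightarrow> real" where "energy t = integral {0..1} (\<lambda>x. (u t x)\<^sup>2 / 2)"
definition dissipation :: "real \<Rightarrow> real" where "dissipation t = integral {0..1} (\<lambda>x. (ux t x)\<^sup>2)"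

lemma dissipation_cont: "continuous_on {0..} dissipation"
  unfolding dissipation_def box_real(2)[symmetric]
proof (rule integral_continuous_on_param)
  have "continuous_on ({0..} \<times> cbox 0 1) (\<lambda>p. (case p of (t, x) \<Rightarrow> ux t x)\<^sup>2)"
    by (intro continuous_on_power continuous_on_subset[OF ux_cont]) auto
  then show "continuous_on ({0..} \<times> cbox 0 1) (\<lambda>(t, x). (ux t x)\<^sup>2)" by (simp add: case_prod_beta)
qed

lemma energy_cont: "continuous_on {0..} energy"
  unfolding energy_def box_real(2)[symmetric]
proof (rule integral_continuous_on_param)
  have "continuous_on ({0..} \<times> cbox 0 1) (\<lambda>p. (case p of (t, x) \<Rightarrow> u t x)\<^sup>2 / 2)"
    by (intro continuous_on_divide continuous_on_power continuous_on_subset[OF u_cont] continuous_on_const) auto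
  then show "continuous_on ({0..} \<times> cbox 0 1) (\<lambda>(t, x). (u t x)\<^sup>2 / 2)" by (simp add: case_prod_beta)
qed

text \<open>Multiplying the equation by \<open>u\<close> exhibits
  \<open>u * ut + \<nu> * ux\<^sup>2\<close> as the space derivative of the flux
  \<open>\<nu> * (u * ux) - u ^ 3 / 3\<close>, which is periodic and so integrates to zero.\<close>

lemma energy_DERIV:
  assumes t: "t > 0"
  shows "(energy has_real_derivative - \<nu> * dissipation t) (at t)"
proof -
  have "((\<lambda>t. integral (cbox 0 1) (\<lambda>x. (u t x)\<^sup>2 / 2)) has_real_derivative
      integral (cbox 0 1) (\<lambda>x. u t x * ut t x)) (at t within {0<..})"
  proof (rule leibniz_rule_field_derivative)
    show "((\<lambda>t. (u t x)\<^sup>2 / 2) has_real_derivative u s x * ut s x) (at s within {0<..})"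
      if "s \<in> {0<..}" for s x
      using u_DERIV_time[of s x] that
      by (auto intro!: derivative_eq_intros intro: has_field_derivative_at_within)
    show "(\<lambda>x. (u s x)\<^sup>2 / 2) integrable_on cbox 0 1" if "s \<in> {0<..}" for s
      using that by (intro integrable_continuous continuous_intros continuous_on_subset[OF u_slice_cont(1)]) auto
    have "continuous_on ({0<..} \<times> cbox 0 1) (\<lambda>p. (case p of (t, x) \<Rightarrow> u t x) * (case p of (t, x) \<Rightarrow> ut t x))"
      by (intro continuous_on_mult continuous_on_subset[OF u_cont] continuous_on_subset[OF ut_cont]) auto
    then show "continuous_on ({0<..} \<times> cbox 0 1) (\<lambda>(t, x). u t x * ut t x)" by (simp add: case_prod_beta)
  qed (use t in auto)
  then have D: "(energy has_real_derivative integral {0..1} (\<lambda>x. u t x * ut t x)) (at t)"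
    using t by (simp add: energy_def[abs_def] at_within_open[of t "{0<..}"])
  have t0: "t \<ge> 0" using t by simp
  define H where "H x = \<nu> * (u t x * ux t x) - (u t x)^3 / 3" for x
  have H: "(H has_real_derivative u t x * ut t x + \<nu> * (ux t x)\<^sup>2) (at x)" for x
  proof -
    have "(H has_real_derivative \<nu> * (ux t x * ux t x + uxx t x * u t x) - 3 * (u t x)^2 * ux t x / 3) (at x)"
      unfolding H_def using u_DERIV[OF t0, of x] ux_DERIV[OF t0, of x]
      by (auto intro!: derivative_eq_intros)
    moreover have "\<nu> * (ux t x * ux t x + uxx t x * u t x) - 3 * (u t x)^2 * ux t x / 3
        = u t x * ut t x + \<nu> * (ux t x)\<^sup>2"
      using arg_cong[OF burgers[of t x], of "\<lambda>z. u t x * z"] by (simp add: algebra_simps power2_eq_square)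
    ultimately show ?thesis by simp
  qed
  have "((\<lambda>x. u t x * ut t x + \<nu> * (ux t x)\<^sup>2) has_integral (H 1 - H 0)) {0..1}"
    using H by (intro fundamental_theorem_of_calculus)
      (auto simp: has_real_derivative_iff_has_vector_derivative[symmetric] intro: has_field_derivative_at_within)
  moreover have "u t 1 = u t 0" "ux t 1 = ux t 0"
    using u_periodic[OF t0, unfolded circle_fun_def, THEN spec, of 0] by auto
  then have "H 1 = H 0" by (simp add: H_def)
  ultimately have "integral {0..1} (\<lambda>x. u t x * ut t x + \<nu> * (ux t x)\<^sup>2) = 0"
    by (simp add: integral_unique)
  moreover have "(\<lambda>x. u t x * ut t x) integrable_on {0..1}" "(\<lambda>x. \<nu> * (ux t x)\<^sup>2) integrable_on {0..1}"
    using u_slice_cont[OF t0]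
    by (auto intro!: integrable_continuous_interval continuous_intros intro: continuous_on_subset)
  ultimately have "integral {0..1} (\<lambda>x. u t x * ut t x) = - \<nu> * dissipation t"
    by (simp add: integral_add dissipation_def)
  then show ?thesis using D by simp
qed

lemma energy_small:
  assumes "t > 0"
  shows "energy t \<le> 1 / (2 * t\<^sup>2)"
proof -
  have "energy t \<le> integral {0..1} (\<lambda>x::real. 1 / (2 * t\<^sup>2))"
    unfolding energy_def
  proof (rule integral_le)
    show "(\<lambda>x. (u t x)\<^sup>2 / 2) integrable_on {0..1}"
      using assms by (intro integrable_continuous_interval continuous_intros continuous_on_subset[OF u_slice_cont(1)]) auto
    show "(u t x)\<^sup>2 / 2 \<le> 1 / (2 * t\<^sup>2)" if "x \<in> {0..1}" for x
      using power_mono[OF u_bound_oleinik[OF assms that], of 2] by (simp add: power_divide)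
  qed (auto intro!: integrable_continuous_interval)
  then show ?thesis by simp
qed

text \<open>The mean value theorem selects one time at which
  \<open>T * \<nu> * dissipation t\<close> equals the whole energy loss up to \<open>T\<close>. One
  time is enough because the norm to be bounded is a supremum over time.\<close>

lemma energy_dissipated:
  assumes "T > 0"
  shows "\<exists>t>0. energy 0 \<le> 1 / (2 * T\<^sup>2) + T * \<nu> * dissipation t"
proof -
  have "\<exists>l z. 0 < z \<and> z < T \<and> (energy has_real_derivative l) (at z) \<and> energy T - energy 0 = (T - 0) * l"
  proof (rule MVT)
    show "continuous_on {0..T} energy" by (rule continuous_on_subset[OF energy_cont]) auto
    show "energy differentiable at x" if "0 < x" for x
      using energy_DERIV[OF that] real_differentiable_def by blast
  qed (rule assms)
  then obtain l z where z: "0 < z" "(energy has_real_derivative l) (at z)" "energy T - energy 0 = T * l"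
    by auto
  have "l = - \<nu> * dissipation z" using DERIV_unique[OF z(2) energy_DERIV[OF z(1)]] .
  then show ?thesis using z energy_small[OF assms] by (intro exI[of _ z]) auto
qed

end

section \<open>Norms on the circle\<close>

text \<open>Bridges the Lebesgue integrals of the definitions and the gauge integrals of the
  calculus lemmas; the two domains differ by the null set \<open>{1}\<close>.\<close>

lemma set_integral_circle:
  fixes h :: "real \<Rightarrow> real"
  assumes "continuous_on UNIV h"
  shows "set_integrable lborel {0..<1} h" "(\<integral>x\<in>{0..<1}. h x \<partial>lborel) = integral {0..1} h"
proof -
  have "set_integrable lborel {0..1} h"
    using assms continuous_on_subset by (intro borel_integrable_atLeastAtMost') blast
  then show int: "set_integrable lborel {0..<1} h"
    by (rule set_integrable_subset) auto
  have "integral {0..<1} h = integral {0..1} h"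
  proof (rule integral_spike_set)
    show "negligible {x \<in> {0..<1} - {0..1}. h x \<noteq> 0}" by (rule negligible_subset[of "{}"]) auto
    show "negligible {x \<in> {0..1} - {0..<1}. h x \<noteq> 0}" by (rule negligible_subset[of "{1}"]) auto
  qed
  then show "(\<integral>x\<in>{0..<1}. h x \<partial>lborel) = integral {0..1} h"
    using set_borel_integral_eq_integral(2)[OF int] by simp
qed

lemma L2_norm_continuous:
  assumes "continuous_on UNIV f"
  shows "L2_norm f = ennreal (sqrt (integral {0..1} (\<lambda>x. (f x)\<^sup>2)))"
proof -
  have c: "continuous_on UNIV (\<lambda>x. (f x)\<^sup>2)" using assms by (intro continuous_intros)
  note i = set_integral_circle[OF c]
  have "(\<integral>\<^sup>+ x \<in> {0..<1}. ennreal ((f x)\<^sup>2) \<partial>lborel)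
      = (\<integral>\<^sup>+ x. ennreal (indicator {0..<1} x *\<^sub>R (f x)\<^sup>2) \<partial>lborel)"
    by (intro nn_integral_cong) (auto simp: indicator_def)
  also have "\<dots> = ennreal (\<integral>x. indicator {0..<1} x *\<^sub>R (f x)\<^sup>2 \<partial>lborel)"
    using i(1) by (intro nn_integral_eq_integral) (auto simp: set_integrable_def)
  also have "\<dots> = ennreal (integral {0..1} (\<lambda>x. (f x)\<^sup>2))"
    using i(2) by (simp add: set_lebesgue_integral_def)
  finally show ?thesis
    by (simp add: L2_norm_def ennreal_sqrt_def Henstock_Kurzweil_Integration.integral_nonneg
        integrable_continuous_interval continuous_on_subset[OF c])
qed

lemma continuous_in_L2: "circle_fun f \<Longrightarrow> continuous_on UNIV f \<Longrightarrow> f \<in> L2"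
  by (simp add: L2_def L2_norm_continuous borel_measurable_continuous_onI)

text \<open>The fundamental theorem for the product with the test function, whose boundary terms
  cancel by periodicity.\<close>

lemma has_weak_deriv_C1:
  assumes u: "circle_fun u" and der: "\<And>x. (u has_real_derivative g x) (at x)" and g: "continuous_on UNIV g"
  shows "has_weak_deriv u g"
  unfolding has_weak_deriv_def
proof (intro allI impI)
  fix \<psi> assume \<psi>: "test_fun \<psi>"
  have per: "\<psi> 1 = \<psi> 0" "u 1 = u 0"
    using \<psi> u unfolding test_fun_def circle_fun_def by (metis add_0)+
  have "(deriv ^^ 0) \<psi> differentiable_on UNIV" "(deriv ^^ 1) \<psi> differentiable_on UNIV"
    using \<psi> unfolding test_fun_def by blast+
  then have d: "\<And>x. (\<psi> has_real_derivative deriv \<psi> x) (at x)" and cd: "continuous_on UNIV (deriv \<psi>)"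
    by (auto simp: differentiable_on_def DERIV_deriv_iff_real_differentiable
        intro: differentiable_imp_continuous_on)
  have cu: "continuous_on UNIV u" and c\<psi>: "continuous_on UNIV \<psi>"
    by (rule DERIV_continuous_on, rule der) (rule DERIV_continuous_on, rule d)
  have "((\<lambda>x. u x * deriv \<psi> x + g x * \<psi> x) has_integral (u 1 * \<psi> 1 - u 0 * \<psi> 0)) {0..1}"
  proof (rule fundamental_theorem_of_calculus[where f = "\<lambda>x. u x * \<psi> x"])
    show "((\<lambda>x. u x * \<psi> x) has_vector_derivative u x * deriv \<psi> x + g x * \<psi> x) (at x within {0..1})" for x
    proof -
      have "((\<lambda>x. u x * \<psi> x) has_real_derivative g x * \<psi> x + deriv \<psi> x * u x) (at x within {0..1})"
        by (rule has_field_derivative_at_within[OF DERIV_mult[OF der d]])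
      also have "g x * \<psi> x + deriv \<psi> x * u x = u x * deriv \<psi> x + g x * \<psi> x" by simp
      finally show ?thesis by (simp only: has_real_derivative_iff_has_vector_derivative)
    qed
  qed simp
  then have "integral {0..1} (\<lambda>x. u x * deriv \<psi> x + g x * \<psi> x) = 0"
    using per by (simp add: integral_unique)
  moreover have c: "continuous_on UNIV (\<lambda>x. u x * deriv \<psi> x)" "continuous_on UNIV (\<lambda>x. g x * \<psi> x)"
    using cu c\<psi> cd g by (auto intro!: continuous_intros)
  ultimately show "(\<integral>x\<in>{0..<1}. u x * deriv \<psi> x \<partial>lborel) = - (\<integral>x\<in>{0..<1}. g x * \<psi> x \<partial>lborel)"
    using continuous_on_subset[OF c(1), of "{0..1}"] continuous_on_subset[OF c(2), of "{0..1}"]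
    by (simp add: set_integral_circle integral_add integrable_continuous_interval add_eq_0_iff2)
qed

text \<open>If the essential supremum were below \<open>d t\<close>, continuity would keep
  \<open>d\<close> above it on an interval around \<open>t\<close>, which would then be a null set.
  This is how a bound at one instant becomes a bound on the norm.\<close>

lemma esssup_ge_continuous:
  assumes d: "continuous_on {0<..} d" and F: "\<And>t. t > 0 \<Longrightarrow> F t = ennreal (d t)" and t: "(t::real) > 0"
  shows "ennreal (d t) \<le> esssup (restrict_space lborel {0<..}) F"
proof (rule ccontr)
  define N where "N = esssup (restrict_space lborel {0<..}) F"
  assume "\<not> ?thesis"
  then have less: "N < ennreal (d t)" by (simp add: N_def)
  then have "N < \<infinity>" by (metis ennreal_less_top infinity_ennreal_def order_less_trans)
  then obtain n where n: "n \<ge> 0" "N = ennreal n" by (cases N) auto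
  have "d t > n" using less n by (simp add: ennreal_less_iff)
  have "AE x in restrict_space lborel {0<..}. F x \<le> N" unfolding N_def by (rule esssup_AE)
  then have ae: "AE x in lborel. 0 < x \<longrightarrow> F x \<le> N"
    by (subst (asm) AE_restrict_space_iff) auto
  have "open ({0<..} \<inter> d -` {n<..})"
    by (rule continuous_open_preimage[OF d]) auto
  moreover have "t \<in> {0<..} \<inter> d -` {n<..}" using t \<open>d t > n\<close> by simp
  ultimately obtain e where e: "e > 0" "ball t e \<subseteq> {0<..} \<inter> d -` {n<..}"
    by (meson open_contains_ball)
  have "AE x in lborel. x \<notin> {t - e<..<t + e}"
    using ae
  proof (rule AE_mp, intro AE_I2 impI)
    fix x assume *: "0 < x \<longrightarrow> F x \<le> N"
    show "x \<notin> {t - e<..<t + e}"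
    proof
      assume "x \<in> {t - e<..<t + e}"
      then have "x \<in> ball t e" by (auto simp: dist_real_def)
      then have "x > 0" "d x > n" using e(2) by auto
      then show False using * F[of x] n by (simp add: ennreal_le_iff2)
    qed
  qed
  then have "{t - e<..<t + e} \<in> null_sets lborel"
    by (subst AE_iff_null_sets) auto
  then show False using e(1) by (simp add: null_sets_def)
qed

section \<open>The initial datum\<close>

text \<open>The Cole-Hopf transform of \<open>u0 x = sin (2 * pi * x) / 8\<close> is \<open>exp (c * cos (2 * pi * x))\<close>
  with \<open>c = 1 / (32 * pi * \<nu>)\<close>; the list holds the prefactors of its first derivatives.\<close>

definition exp_cos :: "real \<Rightarrow> nat \<Rightarrow> real \<Rightarrow> real" where
  "exp_cos c k x = (let w = 2 * pi; S = sin (2 * pi * x); D = cos (2 * pi * x) in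
     [1, - c * w * S, c\<^sup>2 * w\<^sup>2 * S\<^sup>2 - c * w\<^sup>2 * D,
      c * w ^ 3 * S + 3 * c\<^sup>2 * w ^ 3 * S * D - c ^ 3 * w ^ 3 * S ^ 3] ! k * exp (c * D))"

lemma cole_hopf_exp_cos:
  assumes "\<nu> > 0"
  shows "cole_hopf \<nu> (exp_cos c)"
proof
  show "\<nu> > 0" by fact
  show "circle_fun (exp_cos c 0)" by (simp add: circle_fun_def exp_cos_def distrib_left)
  show "exp_cos c 0 x > 0" for x by (simp add: exp_cos_def)
  show "continuous_on UNIV (exp_cos c 3)"
    by (auto simp: exp_cos_def[abs_def] Let_def intro!: continuous_intros)
  show "(exp_cos c k has_real_derivative exp_cos c (Suc k) x) (at x)" if k: "k < 3" for k x
  proof -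
    define w S D E where "w = 2 * pi" and "S x = sin (w * x)" and "D x = cos (w * x)" and "E x = exp (c * D x)" for x
    have dS: "(S has_real_derivative w * D x) (at x)" unfolding S_def D_def
      by (auto intro!: derivative_eq_intros)
    have dD: "(D has_real_derivative - w * S x) (at x)" unfolding S_def D_def
      by (auto intro!: derivative_eq_intros)
    have dE: "(E has_real_derivative - (c * w * S x) * E x) (at x)"
      unfolding E_def using dD by (auto intro!: derivative_eq_intros)
    have e: "exp_cos c 0 = E" "exp_cos c (Suc 0) = (\<lambda>x. - c * w * S x * E x)"
      "exp_cos c (Suc (Suc 0)) = (\<lambda>x. (c\<^sup>2 * w\<^sup>2 * (S x)\<^sup>2 - c * w\<^sup>2 * D x) * E x)"
      "exp_cos c (Suc (Suc (Suc 0))) = (\<lambda>x. (c * w ^ 3 * S x + 3 * c\<^sup>2 * w ^ 3 * S x * D x - c ^ 3 * w ^ 3 * S x ^ 3) * E x)"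
      by (auto simp: exp_cos_def Let_def w_def S_def D_def E_def fun_eq_iff)
    from k consider "k = 0" | "k = Suc 0" | "k = Suc (Suc 0)" by linarith
    then show ?thesis
    proof cases
      case 1
      then show ?thesis unfolding 1 e using dE by simp
    next
      case 2
      show ?thesis unfolding 2 e using dS dE
        by (auto intro!: derivative_eq_intros simp: power2_eq_square algebra_simps)
    next
      case 3
      show ?thesis unfolding 3 e using dS dD dE
        by (auto intro!: derivative_eq_intros simp: power2_eq_square power3_eq_cube algebra_simps)
    qed
  qed
qed

theorem theorem1p2:
  shows "\<exists>(u0 :: real \<Rightarrow> real) (c0 :: real).
    u0 \<in> H1 \<and> (\<exists>g\<in>L2. has_weak_deriv u0 g \<and> L2_norm g \<le> 1) \<and>
    (\<integral>x\<in>{0..<1}. u0 x \<partial>lborel) = 0 \<and> c0 > 0 \<and>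
    (\<forall>\<nu>>0. \<exists>v. burgers_solution \<nu> u0 v) \<and>
    (\<forall>u :: real \<Rightarrow> real \<Rightarrow> real \<Rightarrow> real. (\<forall>\<nu>>0. burgers_solution \<nu> u0 (u \<nu>)) \<longrightarrow>
       Liminf (at_right 0) (\<lambda>\<nu>. ennreal \<nu> * (Linf_L2_norm (\<lambda>t. deriv (u \<nu> t)))\<^sup>2) \<ge> ennreal c0)"
proof -
  define u0 :: "real \<Rightarrow> real" where "u0 x = sin (2 * pi * x) / 8" for x
  define g :: "real \<Rightarrow> real" where "g x = 2 * pi / 8 * cos (2 * pi * x)" for x
  \<comment> \<open>By time 16 at least 1/256 - 1/512 = 1/512 of energy is lost, and 1/512 divided
    by 16 is this value.\<close>
  define c0 :: real where "c0 = 1 / 8192"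
  \<comment> \<open>The parameter \<open>c\<close> solves \<open>4 * pi * \<nu> * c = 1 / 8\<close>,
    so that \<open>- 2 * \<nu>\<close> times the logarithmic derivative of
    \<open>exp_cos c 0\<close> is \<open>u0\<close>.\<close>
  define f where "f \<nu> = exp_cos (1 / (32 * pi * \<nu>))" for \<nu>
  have circ: "circle_fun u0" "circle_fun g"
    by (auto simp: circle_fun_def u0_def g_def distrib_left)
  have der: "(u0 has_real_derivative g x) (at x)" for x
    unfolding u0_def g_def by (auto intro!: derivative_eq_intros)
  have cont: "continuous_on UNIV u0" "continuous_on UNIV g"
    unfolding u0_def g_def by (auto intro!: continuous_intros)
  have weak: "has_weak_deriv u0 g" by (rule has_weak_deriv_C1[OF circ(1) der cont(2)])
  have in_L2: "u0 \<in> L2" "g \<in> L2" using circ cont by (auto intro: continuous_in_L2)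
  have "integral {0..1} (\<lambda>x. (g x)\<^sup>2) \<le> integral {0..1} (\<lambda>x::real. 1)"
  proof (rule integral_le)
    show "(\<lambda>x. (g x)\<^sup>2) integrable_on {0..1}"
      by (intro integrable_continuous_interval continuous_intros continuous_on_subset[OF cont(2)]) auto
    show "(g x)\<^sup>2 \<le> 1" for x
    proof -
      have "\<bar>g x\<bar> \<le> 1 * 1"
        unfolding g_def abs_mult using pi_less_4 by (intro mult_mono) auto
      then show ?thesis by (simp add: abs_square_le_1)
    qed
  qed auto
  then have norm: "L2_norm g \<le> 1" using cont(2) by (simp add: L2_norm_continuous)
  have mean: "(\<integral>x\<in>{0..<1}. u0 x \<partial>lborel) = 0"
  proof -
    have "(u0 has_integral (- cos (2 * pi * 1) / (16 * pi) - - cos (2 * pi * 0) / (16 * pi))) {0..1}"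
      by (rule fundamental_theorem_of_calculus[where f = "\<lambda>x. - cos (2 * pi * x) / (16 * pi)"])
         (auto simp: has_real_derivative_iff_has_vector_derivative[symmetric] u0_def intro!: derivative_eq_intros)
    then show ?thesis using cont(1) by (simp add: set_integral_circle integral_unique)
  qed
  have ch: "cole_hopf \<nu> (f \<nu>)" if "\<nu> > 0" for \<nu>
    unfolding f_def using that by (rule cole_hopf_exp_cos)
  have init: "cole_hopf.u \<nu> (f \<nu>) 0 = u0" if "\<nu> > 0" for \<nu>
  proof -
    interpret cole_hopf \<nu> "f \<nu>" using that by (rule ch)
    show ?thesis
      using that unfolding fun_eq_iff u_def q_def \<phi>_def heat_def u0_def
      by (simp add: f_def exp_cos_def)
  qed
  have sol: "burgers_solution \<nu> u0 (cole_hopf.u \<nu> (f \<nu>))" if "\<nu> > 0" for \<nu>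
    using cole_hopf.u_burgers_solution[OF ch[OF that]] init[OF that] by simp
  have lower: "ennreal c0 \<le> ennreal \<nu> * (Linf_L2_norm (\<lambda>t. deriv (v t)))\<^sup>2"
    if \<nu>: "\<nu> > 0" and v: "burgers_solution \<nu> u0 v" for \<nu> v
  proof -
    interpret cole_hopf \<nu> "f \<nu>" using \<nu> by (rule ch)
    \<comment> \<open>Equality at every point, not merely almost everywhere, so that
      \<open>deriv\<close> can be compared.\<close>
    have "v t = u t" if "t \<ge> 0" for t
      using burgers_solution_unique[OF \<nu> v sol[OF \<nu>] that] by blast
    then have "deriv (v t) = ux t" if "t > 0" for t
      using that u_DERIV[of t] by (intro ext DERIV_imp_deriv) auto
    then have L2: "L2_norm (deriv (v t)) = ennreal (sqrt (dissipation t))" if "t > 0" for t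
      using that u_slice_cont(2)[of t] by (simp add: L2_norm_continuous dissipation_def)
    have "((\<lambda>x. (u 0 x)\<^sup>2 / 2) has_integral
        ((1 - sin (2 * pi * 1) * cos (2 * pi * 1) / (2 * pi)) / 256
         - (0 - sin (2 * pi * 0) * cos (2 * pi * 0) / (2 * pi)) / 256)) {0..1}"
    \<comment> \<open>The antiderivative comes from 2 sin^2 = 1 - cos of the double angle, with the
      sine of the double angle written as a product.\<close>
    proof (rule fundamental_theorem_of_calculus[where f = "\<lambda>x. (x - sin (2 * pi * x) * cos (2 * pi * x) / (2 * pi)) / 256"])
      fix x :: real
      have "((\<lambda>x. (x - sin (2 * pi * x) * cos (2 * pi * x) / (2 * pi)) / 256) has_real_derivative
          (1 - ((cos (2 * pi * x))\<^sup>2 - (sin (2 * pi * x))\<^sup>2)) / 256) (at x)"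
        by (auto intro!: derivative_eq_intros simp: power2_eq_square field_simps)
      also have "(1 - ((cos (2 * pi * x))\<^sup>2 - (sin (2 * pi * x))\<^sup>2)) / 256 = (u 0 x)\<^sup>2 / 2"
        by (simp add: init[OF \<nu>] u0_def power_divide cos_squared_eq)
      finally show "((\<lambda>x. (x - sin (2 * pi * x) * cos (2 * pi * x) / (2 * pi)) / 256)
          has_vector_derivative (u 0 x)\<^sup>2 / 2) (at x within {0..1})"
        by (simp add: has_real_derivative_iff_has_vector_derivative[symmetric] has_field_derivative_at_within)
    qed simp
    then have "((\<lambda>x. (u 0 x)\<^sup>2 / 2) has_integral 1 / 256) {0..1}" by simp
    then have "energy 0 = 1 / 256" unfolding energy_def by (rule integral_unique)
    then obtain t where t: "t > 0" "c0 \<le> \<nu> * dissipation t"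
      using energy_dissipated[of 16] by (auto simp: c0_def)
    \<comment> \<open>The sign of \<open>dissipation t\<close> is read off from
      \<open>c0 > 0\<close>; it allows the square of \<open>sqrt\<close> to be undone below.\<close>
    then have "0 < \<nu> * dissipation t" by (simp add: c0_def)
    then have diss: "dissipation t \<ge> 0" using \<nu> by (simp add: zero_less_mult_iff)
    have "ennreal (sqrt (dissipation t)) \<le> Linf_L2_norm (\<lambda>t. deriv (v t))"
      unfolding Linf_L2_norm_def
      by (rule esssup_ge_continuous[OF _ L2 t(1)])
         (auto intro!: continuous_intros continuous_on_subset[OF dissipation_cont])
    then have "(ennreal (sqrt (dissipation t)))\<^sup>2 \<le> (Linf_L2_norm (\<lambda>t. deriv (v t)))\<^sup>2"
      by (rule power_mono) simp
    then have "ennreal (dissipation t) \<le> (Linf_L2_norm (\<lambda>t. deriv (v t)))\<^sup>2"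
      using diss by (simp add: ennreal_power)
    then have "ennreal \<nu> * ennreal (dissipation t) \<le> ennreal \<nu> * (Linf_L2_norm (\<lambda>t. deriv (v t)))\<^sup>2"
      by (rule mult_left_mono) simp
    moreover have "ennreal c0 \<le> ennreal \<nu> * ennreal (dissipation t)"
      using t(2) \<nu> diss by (simp add: ennreal_mult[symmetric])
    ultimately show ?thesis by (rule order_trans[rotated])
  qed
  have "ennreal c0 \<le> Liminf (at_right 0) (\<lambda>\<nu>. ennreal \<nu> * (Linf_L2_norm (\<lambda>t. deriv (u \<nu> t)))\<^sup>2)"
    if "\<forall>\<nu>>0. burgers_solution \<nu> u0 (u \<nu>)" for u
    using that lower by (intro Liminf_bounded) (auto simp: eventually_at_right_field intro!: exI[of _ 1])
  moreover have "c0 > 0" by (simp add: c0_def)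
  ultimately show ?thesis
    using in_L2 weak norm mean sol unfolding H1_def by blast
qed

end
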